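(* Let $f:\mathbb{R}^d\to\mathbb{R}$ be $\mathcal C^1$, bounded from below, subanalytic, with globally $L_f$-Lipschitz gradient. Let $(\sigma_k)_{k\ge 0}$ be a (deterministic) sequence of reals with $\sigma_{k+1}\le\sigma_k$ for all $k$ and $\sigma_k\to\epsilon>0$, and set $I_\epsilon=[\epsilon,\sigma_0]$. Let $(g_\sigma)_{\sigma>0}$ be a family of functions $g_\sigma:\mathbb{R}^d\to\mathbb{R}$ such that $(x,\sigma)\mapsto g_\sigma(x)$ is jointly $\mathcal C^2$ and subanalytic on $\mathbb{R}^d\times(0,\infty)$, $\nabla g_\sigma$ is $L_g$-Lipschitz for all $\sigma\in I_\epsilon$, and there are positive constants $c_0,C_0,M_g$ such that for all $x\in\mathbb{R}^d$ and $\sigma\in I_\epsilon$, $$g_\sigma(x)\ge c_0\|x\|^2-C_0,\qquad |\partial_\sigma g_\sigma(x)|\le M_g(1+\|x\|^2).$$ Put $D_\sigma=\mathrm{Id}-\nabla g_\sigma$ and let $\lambda>0$. Let $(\gamma_k)_{k\ge0}$ be (deterministic) stepsizes and $\bar\gamma$ a constant such that $$0<\gamma_k\le\bar\gamma,\qquad (L_f+\lambda L_g)\bar\gamma<2,\qquad \sum_k\gamma_k=\infty,\qquad \sum_k\gamma_k^2<\infty .$$ Let $x_0\in\mathbb{R}^d$ be deterministic, let $(Z_{k})_{k\ge1}$ be i.i.d. $\mathcal N(0,I_d)$ random vectors, and define $$x_{k+1}=x_k-\gamma_k\bigl[\nabla f(x_k)+\lambda\bigl(x_k-D_{\sigma_k}(x_k+\sigma_kZ_{k+1})\bigr)\bigr],\qquad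 k\ge0 .$$ For $\sigma\in I_\epsilon$ let $\tilde g_\sigma(x)=\mathbb{E}_Z[g_\sigma(x+\sigma Z)]$ with $Z\sim\mathcal N(0,I_d)$, and $F_\sigma=f+\lambda\tilde g_\sigma$. Then, almost surely, $\|\nabla F_\epsilon(x_k)\|\to0$, $\|x_{k+1}-x_k\|\to0$, and every cluster point of $(x_k)$ is a critical point of $F_\epsilon$; in particular, $\operatorname{dist}(x_k,\operatorname{crit}F_\epsilon)\to0$ almost surely. Moreover $$\min_{0\le k\le K}\mathbb{E}\|\nabla F_{\sigma_k}(x_k)\|^2=\mathcal O\Bigl(\bigl(\textstyle\sum_{j=0}^{K}\gamma_j\bigr)^{-1}\Bigr)\quad\text{as }K\to\infty .$$
   Context: $\nabla$ denotes the gradient with respect to $x$. $\operatorname{crit}F_\epsilon=\{x\in\mathbb{R}^d:\nabla F_\epsilon(x)=0\}$ and $\operatorname{dist}$ is Euclidean distance to a set. No convexity of $f$ or $g_\sigma$ is assumed. *)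

theory Defs
  imports
    "HOL-Analysis.Analysis"
    "HOL-Probability.Probability"
    "HOL-Library.Landau_Symbols"
begin

definition grad :: "('a::real_inner \<Rightarrow> real) \<Rightarrow> 'a \<Rightarrow> 'a" where
  "grad f x = (THE D. GDERIV f x :> D)"

definition crit :: "('a::real_inner \<Rightarrow> real) \<Rightarrow> 'a set" where
  "crit f = {x. grad f x = 0}"

text \<open>Both classes are only used on open sets, where \<open>at x\<close> agrees with \<open>at x within S\<close>.\<close>

definition C1_on :: "'a set \<Rightarrow> ('a::real_normed_vector \<Rightarrow> 'b::real_normed_vector) \<Rightarrow> bool" where
  "C1_on S f \<longleftrightarrow> (\<exists>f'. (\<forall>x\<in>S. (f has_derivative blinfun_apply (f' x)) (at x)) \<and> continuous_on S f')"

definition C2_on :: "'a set \<Rightarrow> ('a::real_normed_vector \<Rightarrow> 'b::real_normed_vector) \<Rightarrow> bool" where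
  "C2_on S f \<longleftrightarrow> (\<exists>f'. (\<forall>x\<in>S. (f has_derivative blinfun_apply (f' x)) (at x)) \<and> C1_on S f')"

text \<open>
  The definition of a subanalytic set quantifies over the dimension of an auxiliary space, so
  semianalytic sets are defined in the spaces \<^const>\<open>Euclidean_space\<close> \<open>n\<close>, whose dimension is a
  natural number. Their points are the sequences vanishing from index \<open>n\<close> on.
\<close>

definition real_analytic_at :: "nat \<Rightarrow> ((nat \<Rightarrow> real) \<Rightarrow> real) \<Rightarrow> (nat \<Rightarrow> real) \<Rightarrow> bool" where
  "real_analytic_at n h p \<longleftrightarrow>
     (\<exists>c r. r > 0 \<and>
       (\<forall>v\<in>topspace (Euclidean_space n). (\<forall>i<n. \<bar>v i - p i\<bar> < r) \<longrightarrow>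
          ((\<lambda>\<alpha>. c \<alpha> * (\<Prod>i<n. (v i - p i) ^ \<alpha> i)) has_sum h v) ({..<n} \<rightarrow>\<^sub>E (UNIV :: nat set))))"

definition semianalytic :: "nat \<Rightarrow> (nat \<Rightarrow> real) set \<Rightarrow> bool" where
  "semianalytic n A \<longleftrightarrow>
     A \<subseteq> topspace (Euclidean_space n) \<and>
     (\<forall>a\<in>topspace (Euclidean_space n).
        \<exists>V (p::nat) (q::nat) h k. openin (Euclidean_space n) V \<and> a \<in> V \<and>
          (\<forall>i<p. \<forall>j<q. \<forall>v\<in>V. real_analytic_at n (h i j) v \<and> real_analytic_at n (k i j) v) \<and>
          A \<inter> V = {v\<in>V. \<exists>i<p. \<forall>j<q. h i j v = 0 \<and> k i j v > 0})"

text \<open>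
  Subanalytic subsets of an open set \<open>U\<close> of a Euclidean space: near each point of \<open>U\<close> (not only of
  \<open>A\<close>) the set is the projection of a bounded semianalytic set with \<open>m \<ge> 1\<close> further coordinates.
  \<^term>\<open>from_nat_into Basis\<close> enumerates the orthonormal basis on \<open>{..<DIM('a)}\<close>; another
  enumeration only permutes the coordinates.
\<close>

definition subanalytic_in :: "'a::euclidean_space set \<Rightarrow> 'a set \<Rightarrow> bool" where
  "subanalytic_in U A \<longleftrightarrow>
     A \<subseteq> U \<and>
     (\<forall>a\<in>U. \<exists>V m B. open V \<and> a \<in> V \<and> V \<subseteq> U \<and> 1 \<le> m \<and>
        semianalytic (DIM('a) + m) B \<and> (\<exists>R. \<forall>v\<in>B. \<forall>i. \<bar>v i\<bar> \<le> R) \<and>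
        A \<inter> V = {x. \<exists>v\<in>B. \<forall>i<DIM('a). v i = x \<bullet> from_nat_into Basis i})"

definition subanalytic_on :: "'a::euclidean_space set \<Rightarrow> ('a \<Rightarrow> real) \<Rightarrow> bool" where
  "subanalytic_on U f \<longleftrightarrow> subanalytic_in (U \<times> (UNIV :: real set)) ((\<lambda>x. (x, f x)) ` U)"

text \<open>The law \<open>N(0, I)\<close>; the product equals \<open>(2\<pi>) powr (-d/2) * exp (- (norm z)\<^sup>2 / 2)\<close>.\<close>

definition std_gaussian :: "'a::euclidean_space measure" where
  "std_gaussian = density lborel (\<lambda>z. ennreal (\<Prod>b\<in>Basis. std_normal_density (z \<bullet> b)))"

definition smoothed :: "(real \<Rightarrow> 'a::euclidean_space \<Rightarrow> real) \<Rightarrow> real \<Rightarrow> 'a \<Rightarrow> real" where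
  "smoothed g s x = (\<integral>z. g s (x + s *\<^sub>R z) \<partial>std_gaussian)"

definition denoiser :: "(real \<Rightarrow> 'a::euclidean_space \<Rightarrow> real) \<Rightarrow> real \<Rightarrow> 'a \<Rightarrow> 'a" where
  "denoiser g s y = y - grad (g s) y"

definition objective ::
    "('a::euclidean_space \<Rightarrow> real) \<Rightarrow> real \<Rightarrow> (real \<Rightarrow> 'a \<Rightarrow> real) \<Rightarrow> real \<Rightarrow> 'a \<Rightarrow> real" where
  "objective f lam g s x = f x + lam * smoothed g s x"

end

theory Submission
  imports Defs
begin

text \<open>
  Write \<open>F\<^sub>k = F\<^bsub>\<sigma> k\<^esub>\<close>. The recursion is \<open>x\<^sub>k\<^sub>+\<^sub>1 = x\<^sub>k - \<gamma>\<^sub>k (\<nabla>F\<^sub>k(x\<^sub>k) + n\<^sub>k)\<close>, where the noise \<open>n\<^sub>k\<close> is centred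
  given the past and bounded by an affine function of \<open>\<parallel>Z\<^sub>k\<^sub>+\<^sub>1\<parallel>\<close>, because \<open>\<nabla>g\<^bsub>\<sigma>\<^esub>\<close> is Lipschitz. Up to an
  additive constant \<open>F\<^sub>k\<close> dominates \<open>1 + \<parallel>x\<parallel>\<^sup>2\<close>, so the bound on \<open>\<partial>\<^sub>\<sigma> g\<close> makes the passage from \<open>F\<^sub>k\<close> to
  \<open>F\<^sub>k\<^sub>+\<^sub>1\<close> cost a factor \<open>1 + a\<^sub>k\<close> with \<open>\<Sum> a\<^sub>k < \<infinity>\<close>, by telescoping of \<open>\<sigma>\<close>. After division by
  \<open>\<Prod> (1 + a\<^sub>j)\<close> the descent lemma bounds \<open>\<Sum> \<gamma>\<^sub>k E\<parallel>\<nabla>F\<^sub>k(x\<^sub>k)\<parallel>\<^sup>2\<close>, which is the rate. As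
  \<open>\<parallel>\<nabla>F\<^sub>k\<parallel>\<^sup>2\<close> is at most a multiple of \<open>F\<^sub>k\<close>, the martingales \<open>\<Sum> \<gamma>\<^sub>k n\<^sub>k\<close> and
  \<open>\<Sum> \<gamma>\<^sub>k \<nabla>F\<^sub>k(x\<^sub>k) \<bullet> n\<^sub>k\<close> (with bounded weights) are bounded in \<open>L\<^sup>2\<close> and converge almost surely;
  the descent inequality then bounds \<open>x\<^sub>k\<close> pathwise, and the rest is deterministic. Smooth functions
  that are uniformly close have close gradients, which transfers the limit from \<open>F\<^sub>k\<close> to \<open>F\<^bsub>\<epsilon>\<^esub>\<close>.
\<close>

subsection \<open>Smooth functions and their gradients\<close>

lemma GDERIV_imp_grad: "GDERIV f x :> D \<Longrightarrow> grad f x = D"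
  unfolding grad_def
proof (rule the_equality)
  fix D' assume "GDERIV f x :> D" "GDERIV f x :> D'"
  then have "(\<lambda>h. h \<bullet> D') = (\<lambda>h. h \<bullet> D)"
    unfolding gderiv_def by (rule has_derivative_unique[symmetric])
  then have "(D' - D) \<bullet> (D' - D) = 0"
    by (metis inner_diff_right diff_self)
  then show "D' = D" by simp
qed

text \<open>Finite-dimensional Riesz representation: a linear functional \<open>D\<close> is the
  inner product with the vector whose coordinates are its values on the basis.\<close>

lemma has_derivative_imp_GDERIV:
  fixes f :: "'a::euclidean_space \<Rightarrow> real"
  assumes "(f has_derivative D) (at x)"
  shows "GDERIV f x :> grad f x"
proof -
  interpret D: bounded_linear D using assms by (rule has_derivative_bounded_linear)
  have "D = (\<lambda>h. h \<bullet> (\<Sum>b\<in>Basis. D b *\<^sub>R b))"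
  proof
    fix h
    have "D h = D (\<Sum>b\<in>Basis. (h \<bullet> b) *\<^sub>R b)" by (simp add: euclidean_representation)
    then show "D h = h \<bullet> (\<Sum>b\<in>Basis. D b *\<^sub>R b)"
      by (simp add: D.sum D.scaleR inner_sum_right mult.commute)
  qed
  then have "GDERIV f x :> (\<Sum>b\<in>Basis. D b *\<^sub>R b)"
    unfolding gderiv_def using assms by simp
  then show ?thesis using GDERIV_imp_grad by metis
qed

lemma C1_on_UNIV_GDERIV:
  fixes f :: "'a::euclidean_space \<Rightarrow> real"
  assumes "C1_on UNIV f"
  shows "GDERIV f x :> grad f x"
  using assms unfolding C1_on_def by (auto intro: has_derivative_imp_GDERIV)

text \<open>The chain rule restricts the joint derivative to the slice with \<open>s\<close> fixed
  and to the slice with \<open>y\<close> fixed.\<close>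

lemma C2_on_partial_derivatives:
  fixes g :: "real \<Rightarrow> 'a::euclidean_space \<Rightarrow> real"
  assumes g: "C2_on (UNIV \<times> {0<..}) (\<lambda>(y, s). g s y)" and s: "s > 0"
  shows "GDERIV (g s) y :> grad (g s) y"
    and "((\<lambda>t. g t y) has_real_derivative deriv (\<lambda>t. g t y) s) (at s)"
proof -
  obtain D where D: "((\<lambda>(y, s). g s y) has_derivative D) (at (y, s))"
    using g s unfolding C2_on_def by fastforce
  interpret D: bounded_linear D using D by (rule has_derivative_bounded_linear)
  have "((\<lambda>y. (y, s)) has_derivative (\<lambda>h. (h, 0))) (at y)"
    by (auto intro!: derivative_eq_intros)
  from has_derivative_compose[OF this D] show "GDERIV (g s) y :> grad (g s) y"
    by (intro has_derivative_imp_GDERIV) simp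
  have "((\<lambda>t. (y, t)) has_derivative (\<lambda>h. (0, h))) (at s)"
    by (auto intro!: derivative_eq_intros)
  from has_derivative_compose[OF this D]
  have "((\<lambda>t. g t y) has_derivative (\<lambda>h. D (0, h))) (at s)" by simp
  then have "(\<lambda>t. g t y) differentiable (at s)" by (rule differentiableI)
  then show "((\<lambda>t. g t y) has_real_derivative deriv (\<lambda>t. g t y) s) (at s)"
    by (simp add: DERIV_deriv_iff_real_differentiable)
qed

text \<open>Two-sided descent lemma. Instead of integrating the derivative along the segment, a
  parabola in \<open>t\<close> is subtracted, with either sign of its quadratic part, which makes
  the remaining function monotone on the unit interval.\<close>

lemma lipschitz_grad_descent:
  fixes f :: "'a::euclidean_space \<Rightarrow> real"
  assumes G: "\<And>x. GDERIV f x :> G x" and L: "L-lipschitz_on UNIV G"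
  shows "\<bar>f (x + h) - f x - G x \<bullet> h\<bar> \<le> L / 2 * (norm h)\<^sup>2"
proof -
  have deriv: "((\<lambda>t. f (x + t *\<^sub>R h)) has_real_derivative (G (x + t *\<^sub>R h) \<bullet> h)) (at t)" for t
  proof -
    have "((\<lambda>t. f (x + t *\<^sub>R h)) has_derivative (\<lambda>u. (0 + u *\<^sub>R h) \<bullet> G (x + t *\<^sub>R h))) (at t)"
      using G[of "x + t *\<^sub>R h"] unfolding gderiv_def
      by (intro has_derivative_compose[of "\<lambda>t. x + t *\<^sub>R h", where g = f]) (auto intro!: derivative_eq_intros)
    then show ?thesis
      unfolding has_field_derivative_def
      by (rule has_derivative_eq_rhs) (auto simp: fun_eq_iff inner_commute)
  qed
  have incr: "\<bar>G (x + t *\<^sub>R h) \<bullet> h - G x \<bullet> h\<bar> \<le> L * t * (norm h)\<^sup>2" if "0 \<le> t" for t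
  proof -
    have "\<bar>G (x + t *\<^sub>R h) \<bullet> h - G x \<bullet> h\<bar> \<le> norm (G (x + t *\<^sub>R h) - G x) * norm h"
      by (simp add: inner_diff_left[symmetric] Cauchy_Schwarz_ineq2)
    also have "\<dots> \<le> (L * norm (t *\<^sub>R h)) * norm h"
      using lipschitz_on_normD[OF L, of "x + t *\<^sub>R h" x] by (intro mult_right_mono) auto
    finally show ?thesis using that by (simp add: power2_eq_square ac_simps)
  qed
  \<comment> \<open>The scalars 1 and 0 stay unsimplified so that both sides are visibly values of
    one function of \<open>t\<close>, as the monotonicity rule requires.\<close>
  have "f (x + 1 *\<^sub>R h) - (1 * (G x \<bullet> h) + L / 2 * 1\<^sup>2 * (norm h)\<^sup>2)
      \<le> f (x + 0 *\<^sub>R h) - (0 * (G x \<bullet> h) + L / 2 * 0\<^sup>2 * (norm h)\<^sup>2)"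
  proof (rule DERIV_nonpos_imp_nonincreasing[OF zero_le_one])
    fix t :: real assume t: "0 \<le> t" "t \<le> 1"
    have "((\<lambda>t. f (x + t *\<^sub>R h) - (t * (G x \<bullet> h) + L / 2 * t\<^sup>2 * (norm h)\<^sup>2)) has_real_derivative
        (G (x + t *\<^sub>R h) \<bullet> h - (G x \<bullet> h + L * t * (norm h)\<^sup>2))) (at t)"
      by (auto intro!: derivative_eq_intros deriv)
    then show "\<exists>y. ((\<lambda>t. f (x + t *\<^sub>R h) - (t * (G x \<bullet> h) + L / 2 * t\<^sup>2 * (norm h)\<^sup>2))
        has_real_derivative y) (at t) \<and> y \<le> 0"
      using incr[OF t(1)] by (intro exI conjI) auto
  qed
  moreover have "f (x + 0 *\<^sub>R h) - (0 * (G x \<bullet> h) - L / 2 * 0\<^sup>2 * (norm h)\<^sup>2)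
      \<le> f (x + 1 *\<^sub>R h) - (1 * (G x \<bullet> h) - L / 2 * 1\<^sup>2 * (norm h)\<^sup>2)"
  proof (rule DERIV_nonneg_imp_nondecreasing[OF zero_le_one])
    fix t :: real assume t: "0 \<le> t" "t \<le> 1"
    have "((\<lambda>t. f (x + t *\<^sub>R h) - (t * (G x \<bullet> h) - L / 2 * t\<^sup>2 * (norm h)\<^sup>2)) has_real_derivative
        (G (x + t *\<^sub>R h) \<bullet> h - (G x \<bullet> h - L * t * (norm h)\<^sup>2))) (at t)"
      by (auto intro!: derivative_eq_intros deriv)
    then show "\<exists>y. ((\<lambda>t. f (x + t *\<^sub>R h) - (t * (G x \<bullet> h) - L / 2 * t\<^sup>2 * (norm h)\<^sup>2))
        has_real_derivative y) (at t) \<and> y \<ge> 0"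
      using incr[OF t(1)] by (intro exI conjI) auto
  qed
  ultimately show ?thesis by (intro abs_leI) (simp_all add: field_simps)
qed

text \<open>Serves for functions given by an integral: a quadratic remainder estimate passes through
  the integral, and differentiability is then read off from it.\<close>

lemma GDERIV_of_quadratic_remainder:
  fixes f :: "'a::euclidean_space \<Rightarrow> real"
  assumes "\<And>h. \<bar>f (x + h) - f x - D \<bullet> h\<bar> \<le> C * (norm h)\<^sup>2"
  shows "GDERIV f x :> D"
  unfolding gderiv_def has_derivative_at
proof
  show "bounded_linear (\<lambda>h. h \<bullet> D)" by (rule bounded_linear_inner_left)
  show "(\<lambda>h. norm (f (x + h) - f x - h \<bullet> D) / norm h) \<midarrow>0\<rightarrow> 0"
  proof (rule Lim_null_comparison)
    show "\<forall>\<^sub>F h in at 0. norm (norm (f (x + h) - f x - h \<bullet> D) / norm h) \<le> C * norm h"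
      using assms by (intro always_eventually)
        (auto simp: divide_le_eq power2_eq_square inner_commute mult.assoc)
    show "((\<lambda>h. C * norm h) \<longlongrightarrow> 0) (at 0)"
      by (auto intro!: tendsto_eq_intros)
  qed
qed

text \<open>A gradient step of length \<open>1 / (L + 1)\<close> lowers \<open>f\<close> by at least
  half that length times the squared gradient norm, yet never below \<open>m\<close>. Using
  \<open>L + 1\<close> covers \<open>L = 0\<close>.\<close>

lemma grad_norm_sq_le:
  fixes f :: "'a::euclidean_space \<Rightarrow> real"
  assumes G: "\<And>x. GDERIV f x :> G x" and L: "L-lipschitz_on UNIV G" and m: "\<And>x. m \<le> f x"
  shows "(norm (G x))\<^sup>2 \<le> 2 * (L + 1) * (f x - m)"
proof -
  have L0: "L \<ge> 0" using L by (rule lipschitz_on_nonneg)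
  define t where "t = 1 / (L + 1)"
  have t: "t > 0" "t * (L + 1) = 1" using L0 by (auto simp: t_def)
  have "f (x + (- t) *\<^sub>R G x) - f x - G x \<bullet> ((- t) *\<^sub>R G x) \<le> L / 2 * (norm ((- t) *\<^sub>R G x))\<^sup>2"
    using lipschitz_grad_descent[OF G L, of x "(- t) *\<^sub>R G x"] by linarith
  also have "\<dots> \<le> (L + 1) / 2 * (norm ((- t) *\<^sub>R G x))\<^sup>2"
    by (intro mult_right_mono) auto
  also have "\<dots> = (t * (L + 1)) * t / 2 * (norm (G x))\<^sup>2"
    by (simp add: power_mult_distrib power2_eq_square)
  finally have "f (x + (- t) *\<^sub>R G x) - f x + t * (norm (G x))\<^sup>2 \<le> t / 2 * (norm (G x))\<^sup>2"
    unfolding t(2) by (simp add: power2_norm_eq_inner)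
  with m[of "x + (- t) *\<^sub>R G x"] have "t * (norm (G x))\<^sup>2 \<le> 2 * (f x - m)"
    by (simp add: algebra_simps)
  then show ?thesis
    using L0 by (simp add: t_def field_simps)
qed

text \<open>
  Compare the values of \<open>f\<^sub>1 - f\<^sub>2\<close> at \<open>x\<close> and at distance \<open>t\<close> in the direction of its gradient.
\<close>

lemma grad_diff_le:
  fixes f\<^sub>1 f\<^sub>2 :: "'a::euclidean_space \<Rightarrow> real"
  assumes G1: "\<And>x. GDERIV f\<^sub>1 x :> G\<^sub>1 x" and L1: "L-lipschitz_on UNIV G\<^sub>1"
    and G2: "\<And>x. GDERIV f\<^sub>2 x :> G\<^sub>2 x" and L2: "L-lipschitz_on UNIV G\<^sub>2"
    and t: "t > 0" and d: "\<And>y. norm (y - x) \<le> t \<Longrightarrow> \<bar>f\<^sub>1 y - f\<^sub>2 y\<bar> \<le> d"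
  shows "norm (G\<^sub>1 x - G\<^sub>2 x) \<le> L * t + 2 * d / t"
\<comment> \<open>Equal gradients leave no direction to normalise; the bound then only needs
  \<open>d \<ge> 0\<close>, which follows from the assumption at \<open>x\<close> itself.\<close>
proof (cases "G\<^sub>1 x = G\<^sub>2 x")
  case True
  then show ?thesis using t d[of x] lipschitz_on_nonneg[OF L1] by simp
next
  case False
  define v where "v = G\<^sub>1 x - G\<^sub>2 x"
  define h where "h = (t / norm v) *\<^sub>R v"
  have v: "norm v > 0" using False by (simp add: v_def)
  have h: "norm h = t" using v t by (simp add: h_def)
  have vh: "v \<bullet> h = t * norm v"
    using v by (simp add: h_def power2_norm_eq_inner[symmetric] power2_eq_square)
  have "\<bar>f\<^sub>1 (x + h) - f\<^sub>1 x - G\<^sub>1 x \<bullet> h\<bar> \<le> L / 2 * t\<^sup>2" "\<bar>f\<^sub>2 (x + h) - f\<^sub>2 x - G\<^sub>2 x \<bullet> h\<bar> \<le> L / 2 * t\<^sup>2"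
    using lipschitz_grad_descent[OF G1 L1, of x h] lipschitz_grad_descent[OF G2 L2, of x h]
    by (simp_all add: h)
  moreover have "\<bar>f\<^sub>1 (x + h) - f\<^sub>2 (x + h)\<bar> \<le> d" "\<bar>f\<^sub>1 x - f\<^sub>2 x\<bar> \<le> d"
    using d[of "x + h"] d[of x] h t by auto
  ultimately have "v \<bullet> h \<le> L * t\<^sup>2 + 2 * d"
    unfolding v_def inner_diff_left by linarith
  then have "norm v \<le> (L * t\<^sup>2 + 2 * d) / t"
    unfolding vh using t by (simp add: pos_le_divide_eq mult.commute)
  also have "\<dots> = L * t + 2 * d / t" using t by (simp add: field_simps power2_eq_square)
  finally show ?thesis by (simp add: v_def)
qed

lemma GDERIV_borel_measurable:
  fixes h :: "'a::euclidean_space \<Rightarrow> real"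
  assumes "\<And>y. GDERIV h y :> H y"
  shows "h \<in> borel_measurable borel"
  using assms unfolding gderiv_def
  by (intro borel_measurable_continuous_onI continuous_at_imp_continuous_on)
    (auto intro: has_derivative_continuous)

lemma lipschitz_borel_measurable:
  fixes H :: "'a::euclidean_space \<Rightarrow> 'a"
  shows "L-lipschitz_on UNIV H \<Longrightarrow> H \<in> borel_measurable borel"
  by (intro borel_measurable_continuous_onI lipschitz_on_continuous_on)

subsection \<open>The standard Gaussian measure\<close>

lemma sets_std_gaussian [simp, measurable_cong]: "sets std_gaussian = sets borel"
  by (simp add: std_gaussian_def)

lemma space_std_gaussian [simp]: "space std_gaussian = UNIV"
  by (simp add: std_gaussian_def)

text \<open>Absorbing \<open>\<phi>\<close> into the density factor of index \<open>b\<close> keeps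
  a product over the coordinates, so the integral factorises and every other factor is 1.\<close>

lemma nn_integral_std_gaussian_coordinate:
  fixes b :: "'a::euclidean_space"
  assumes b: "b \<in> Basis"
    and [measurable]: "\<phi> \<in> borel_measurable borel" and nn: "\<And>t. \<phi> t \<ge> 0"
  shows "(\<integral>\<^sup>+z. ennreal (\<phi> (z \<bullet> b)) \<partial>(std_gaussian :: 'a measure))
    = (\<integral>\<^sup>+t. ennreal (std_normal_density t * \<phi> t) \<partial>lborel)"
proof -
  have one: "(\<integral>\<^sup>+t. ennreal (std_normal_density t) \<partial>lborel) = 1"
    by (subst nn_integral_eq_integral) (auto simp: integral_normal_density)
  have "(\<integral>\<^sup>+z. ennreal (\<phi> (z \<bullet> b)) \<partial>(std_gaussian :: 'a measure))
     = (\<integral>\<^sup>+z. ennreal (\<Prod>c\<in>Basis. std_normal_density (z \<bullet> c)) * ennreal (\<phi> (z \<bullet> b)) \<partial>(lborel :: 'a measure))"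
    unfolding std_gaussian_def by (subst nn_integral_density) auto
  also have "\<dots> = (\<integral>\<^sup>+z. (\<Prod>c\<in>Basis. ennreal (std_normal_density (z \<bullet> c) * (if c = b then \<phi> (z \<bullet> c) else 1)))
      \<partial>(lborel :: 'a measure))"
  proof (rule nn_integral_cong)
    fix z :: 'a
    have "(\<Prod>c\<in>Basis. ennreal (std_normal_density (z \<bullet> c) * (if c = b then \<phi> (z \<bullet> c) else 1)))
       = ennreal ((\<Prod>c\<in>Basis. std_normal_density (z \<bullet> c)) * (\<Prod>c\<in>Basis. if c = b then \<phi> (z \<bullet> c) else 1))"
      by (simp add: prod_ennreal nn prod.distrib)
    also have "(\<Prod>c\<in>Basis. if c = b then \<phi> (z \<bullet> c) else 1) = \<phi> (z \<bullet> b)"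
      using b by (simp add: prod.delta)
    finally show "ennreal (\<Prod>c\<in>Basis. std_normal_density (z \<bullet> c)) * ennreal (\<phi> (z \<bullet> b))
       = (\<Prod>c\<in>Basis. ennreal (std_normal_density (z \<bullet> c) * (if c = b then \<phi> (z \<bullet> c) else 1)))"
      by (simp add: ennreal_mult' nn prod_nonneg)
  qed
  also have "\<dots> = (\<Prod>c\<in>(Basis::'a set). \<integral>\<^sup>+t. ennreal (std_normal_density t * (if c = b then \<phi> t else 1)) \<partial>lborel)"
    by (rule nn_integral_lborel_prod) (auto simp: nn)
  also have "\<dots> = (\<Prod>c\<in>(Basis::'a set). if c = b then \<integral>\<^sup>+t. ennreal (std_normal_density t * \<phi> t) \<partial>lborel else 1)"
    by (rule prod.cong) (auto simp: one)
  also have "\<dots> = (\<integral>\<^sup>+t. ennreal (std_normal_density t * \<phi> t) \<partial>lborel)"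
    using b by (simp add: prod.delta)
  finally show ?thesis .
qed

lemma prob_space_std_gaussian: "prob_space (std_gaussian :: 'a::euclidean_space measure)"
proof
  obtain b :: 'a where b: "b \<in> Basis" using nonempty_Basis by blast
  show "emeasure (std_gaussian :: 'a measure) (space std_gaussian) = 1"
    using nn_integral_std_gaussian_coordinate[OF b, of "\<lambda>_. 1"]
    by (simp add: nn_integral_eq_integral integral_normal_density)
qed

lemma integrable_std_gaussian_norm_sq:
  "integrable (std_gaussian :: 'a::euclidean_space measure) (\<lambda>z. (norm z)\<^sup>2)"
proof -
  have "integrable (std_gaussian :: 'a measure) (\<lambda>z. (z \<bullet> b)\<^sup>2)" if b: "b \<in> Basis" for b
  proof (rule integrableI_nonneg)
    have "integrable lborel (\<lambda>t. std_normal_density t * t ^ 2)"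
      using integrable_normal_moment[of 1 0 2] by simp
    then show "(\<integral>\<^sup>+z. ennreal ((z \<bullet> b)\<^sup>2) \<partial>(std_gaussian :: 'a measure)) < \<infinity>"
      using nn_integral_std_gaussian_coordinate[OF b, of "\<lambda>t. t\<^sup>2"]
      by (simp add: nn_integral_eq_integral)
  qed auto
  then have "integrable (std_gaussian :: 'a measure) (\<lambda>z. \<Sum>b\<in>Basis. (z \<bullet> b)\<^sup>2)"
    by (rule Bochner_Integration.integrable_sum)
  also have "(\<lambda>z :: 'a. \<Sum>b\<in>Basis. (z \<bullet> b)\<^sup>2) = (\<lambda>z. (norm z)\<^sup>2)"
    by (subst power2_norm_eq_inner, subst euclidean_inner) (simp add: power2_eq_square)
  finally show ?thesis .
qed

text \<open>Lebesgue measure and the density are both even. The vanishing first moments below come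
  from this symmetry.\<close>

lemma distr_std_gaussian_uminus:
  "distr std_gaussian borel uminus = (std_gaussian :: 'a::euclidean_space measure)"
proof -
  have "density (distr lborel borel uminus) (\<lambda>z :: 'a. ennreal (\<Prod>b\<in>Basis. std_normal_density (z \<bullet> b)))
     = distr (density lborel (\<lambda>z. ennreal (\<Prod>b\<in>Basis. std_normal_density (- z \<bullet> b)))) borel uminus"
    by (subst density_distr) auto
  moreover have "distr lborel borel uminus = (lborel :: 'a measure)"
    using lborel_affine[of "- 1 :: real" "0 :: 'a"]
    by (simp add: density_1)
  ultimately show ?thesis
    unfolding std_gaussian_def by (simp add: std_normal_density_def)
qed

lemma integral_std_gaussian_inner: "(\<integral>z. y \<bullet> z \<partial>std_gaussian) = 0"
proof -
  have "(\<integral>z. y \<bullet> z \<partial>std_gaussian) = (\<integral>z. y \<bullet> z \<partial>(distr std_gaussian borel uminus))"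
    by (simp add: distr_std_gaussian_uminus)
  also have "\<dots> = (\<integral>z. y \<bullet> (- z) \<partial>std_gaussian)"
    by (rule integral_distr) auto
  finally show ?thesis by simp
qed

lemma integrable_std_gaussian_norm:
  "integrable (std_gaussian :: 'a::euclidean_space measure) norm"
proof -
  interpret prob_space "std_gaussian :: 'a measure" by (rule prob_space_std_gaussian)
  show ?thesis
  proof (rule Bochner_Integration.integrable_bound)
    show "integrable (std_gaussian :: 'a measure) (\<lambda>z. 1 + (norm z)\<^sup>2)"
      by (intro Bochner_Integration.integrable_add integrable_const integrable_std_gaussian_norm_sq)
    have "norm z \<le> 1 + (norm z)\<^sup>2" for z :: 'a
      using power2_diff[of "norm z" 1] by (smt (verit) zero_le_power2 norm_ge_zero one_power2 mult_1_right)
    then show "AE z in (std_gaussian :: 'a measure). norm (norm z) \<le> norm (1 + (norm z)\<^sup>2)"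
      by (intro AE_I2) (auto intro: order_trans)
  qed auto
qed

lemma integrable_std_gaussian_inner: "integrable std_gaussian (\<lambda>z. y \<bullet> z)"
proof (rule Bochner_Integration.integrable_bound)
  show "integrable std_gaussian (\<lambda>z :: 'a. norm y * norm z)"
    by (intro integrable_mult_right integrable_std_gaussian_norm)
  show "AE z in std_gaussian. norm (y \<bullet> z) \<le> norm (norm y * norm z)"
    by (intro AE_I2) (simp add: Cauchy_Schwarz_ineq2)
qed simp

lemma integrable_std_gaussian_id:
  "integrable (std_gaussian :: 'a::euclidean_space measure) (\<lambda>z. z)"
proof (rule Bochner_Integration.integrable_bound[OF integrable_std_gaussian_norm])
  show "(\<lambda>z. z) \<in> borel_measurable (std_gaussian :: 'a measure)"
    by (simp add: measurable_cong_sets[OF sets_std_gaussian refl])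
qed simp

lemma integral_std_gaussian_id: "(\<integral>z. z \<partial>std_gaussian) = (0 :: 'a::euclidean_space)"
proof (rule euclidean_eqI)
  fix b :: 'a
  have "(\<integral>z. z \<partial>std_gaussian) \<bullet> b = (\<integral>z. z \<bullet> b \<partial>std_gaussian)"
    by (rule integral_inner_left[symmetric]) (rule integrable_std_gaussian_id)
  also have "\<dots> = 0" using integral_std_gaussian_inner[of b] by (simp add: inner_commute)
  finally show "(\<integral>z. z \<partial>std_gaussian) \<bullet> b = 0 \<bullet> b" by simp
qed

text \<open>The \<open>itself\<close> argument carries the space, since the value depends on the
  type alone; it is the dimension.\<close>

definition gaussian_variance :: "'a::euclidean_space itself \<Rightarrow> real" where
  "gaussian_variance _ = (\<integral>z. (norm z)\<^sup>2 \<partial>(std_gaussian :: 'a measure))"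

lemma gaussian_variance_nonneg: "gaussian_variance T \<ge> 0"
  by (simp add: gaussian_variance_def)

subsection \<open>Almost sure convergence of square integrable martingales\<close>

lemma abs_mult_le_sum_squares: "\<bar>a * b\<bar> \<le> a\<^sup>2 + b\<^sup>2" for a b :: real
proof -
  have "2 * (\<bar>a\<bar> * \<bar>b\<bar>) \<le> a\<^sup>2 + b\<^sup>2"
    using sum_squares_bound[of "\<bar>a\<bar>" "\<bar>b\<bar>"] by simp
  moreover have "0 \<le> \<bar>a\<bar> * \<bar>b\<bar>" by simp
  ultimately show ?thesis unfolding abs_mult by linarith
qed

text \<open>
  That the conditional expectation of \<open>d k\<close> given \<open>\<F> k\<close> vanishes is expressed by orthogonality
  to the square integrable \<open>\<F> k\<close>-measurable functions.
\<close>

locale martingale_differences = prob_space M for M :: "'w measure" +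
  fixes \<F> :: "nat \<Rightarrow> 'w measure" and d :: "nat \<Rightarrow> 'w \<Rightarrow> real"
  assumes space_\<F>: "\<And>k. space (\<F> k) = space M"
    and \<F>_mono: "\<And>k. sets (\<F> k) \<subseteq> sets (\<F> (Suc k))"
    and \<F>_sub: "\<And>k. sets (\<F> k) \<subseteq> sets M"
    and d_adapted: "\<And>k. d k \<in> borel_measurable (\<F> (Suc k))"
    and d_sq_integrable: "\<And>k. integrable M (\<lambda>w. (d k w)\<^sup>2)"
    and d_orthogonal: "\<And>k U. U \<in> borel_measurable (\<F> k) \<Longrightarrow> integrable M (\<lambda>w. (U w)\<^sup>2) \<Longrightarrow>
      (\<integral>w. U w * d k w \<partial>M) = 0"
    and d_summable: "summable (\<lambda>k. \<integral>w. (d k w)\<^sup>2 \<partial>M)"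
begin

lemma sets_\<F>_le: "i \<le> j \<Longrightarrow> sets (\<F> i) \<subseteq> sets (\<F> j)"
  by (rule lift_Suc_mono_le[of "\<lambda>k. sets (\<F> k)"]) (rule \<F>_mono)

lemma measurable_\<F>_le: "U \<in> borel_measurable (\<F> i) \<Longrightarrow> i \<le> j \<Longrightarrow> U \<in> borel_measurable (\<F> j)"
  using sets_\<F>_le[of i j] by (auto simp: measurable_def space_\<F>)

lemma measurable_\<F>: "U \<in> borel_measurable (\<F> i) \<Longrightarrow> U \<in> borel_measurable M"
  using \<F>_sub[of i] by (auto simp: measurable_def space_\<F>)

lemma partial_sum_adapted:
  "k \<le> n \<Longrightarrow> (\<lambda>w. \<Sum>i=m..<k. d i w) \<in> borel_measurable (\<F> n)"
  by (intro borel_measurable_sum measurable_\<F>_le[OF d_adapted]) auto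

text \<open>
  Stopping the sum once it exceeds \<open>a\<close> keeps the increments orthogonal, and the stopped sum
  still exceeds \<open>a\<close> on the event in question; Chebyshev's inequality for its final value gives
  the maximal inequality.
\<close>

lemma maximal_inequality:
  assumes a: "a > 0"
  shows "prob {w \<in> space M. \<exists>k\<in>{m..n}. \<bar>\<Sum>i=m..<k. d i w\<bar> \<ge> a}
    \<le> (\<Sum>i=m..<n. \<integral>w. (d i w)\<^sup>2 \<partial>M) / a\<^sup>2"
proof -
  \<comment> \<open>No exceedance has occurred by time \<open>j\<close>. The event involves only
    increments of index below \<open>j\<close>, so its indicator is \<open>\<F> j\<close>-measurable
    and multiplies \<open>d j\<close> predictably.\<close>
  define A where "A j = {w \<in> space M. \<forall>k\<in>{m..j}. \<bar>\<Sum>i=m..<k. d i w\<bar> < a}" for j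
  define e where "e j w = indicator (A j) w * d j w" for j w
  have A_sets: "A j \<in> sets (\<F> j)" for j
  proof -
    have "{w \<in> space (\<F> j). \<forall>k\<in>{m..j}. \<bar>\<Sum>i=m..<k. d i w\<bar> < a} \<in> sets (\<F> j)"
      by (intro sets.sets_Collect_finite_All borel_measurable_less borel_measurable_abs
          partial_sum_adapted borel_measurable_const) auto
    then show ?thesis by (simp add: A_def space_\<F>)
  qed
  have A_M: "A j \<in> events" for j using A_sets \<F>_sub by blast
  have d_M [measurable]: "d j \<in> borel_measurable M" for j by (rule measurable_\<F>[OF d_adapted])
  have e_M: "e j \<in> borel_measurable M" for j
    unfolding e_def using A_M by (intro borel_measurable_times borel_measurable_indicator) auto
  have e_adapted: "e j \<in> borel_measurable (\<F> (Suc j))" for j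
    unfolding e_def using A_sets \<F>_mono
    by (intro borel_measurable_times borel_measurable_indicator d_adapted) auto
  have e_sq: "(e j w)\<^sup>2 \<le> (d j w)\<^sup>2" for j w
    by (auto simp: e_def indicator_def)
  have e_int: "integrable M (\<lambda>w. (e j w)\<^sup>2)" for j
    using e_sq e_M by (intro Bochner_Integration.integrable_bound[OF d_sq_integrable[of j]]) auto
  define T where "T k w = (\<Sum>i=m..<k. e i w)" for k w
  have T_M [measurable]: "T k \<in> borel_measurable M" for k
    unfolding T_def by (intro borel_measurable_sum e_M)
  \<comment> \<open>Integrability is carried through the induction because orthogonality is
    available only for square integrable test functions.\<close>
  have T_main: "integrable M (\<lambda>w. (T n w)\<^sup>2) \<and> (\<integral>w. (T n w)\<^sup>2 \<partial>M) \<le> (\<Sum>i=m..<n. \<integral>w. (d i w)\<^sup>2 \<partial>M)"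
    for n
  proof (induction n)
    case 0
    then show ?case by (simp add: T_def)
  next
    case (Suc n)
    show ?case
    proof (cases "m \<le> n")
      case False
      then show ?thesis by (simp add: T_def)
    next
      case True
      have expand: "(T (Suc n) w)\<^sup>2 = (T n w)\<^sup>2 + 2 * (T n w * e n w) + (e n w)\<^sup>2" for w
        using True by (simp add: T_def power2_sum)
      have cross_int: "integrable M (\<lambda>w. T n w * e n w)"
      proof (rule Bochner_Integration.integrable_bound)
        show "integrable M (\<lambda>w. (T n w)\<^sup>2 + (e n w)\<^sup>2)"
          using Suc e_int by (intro Bochner_Integration.integrable_add) auto
        show "AE w in M. norm (T n w * e n w) \<le> norm ((T n w)\<^sup>2 + (e n w)\<^sup>2)"
          using abs_mult_le_sum_squares[of "T n _" "e n _"] by (intro AE_I2) simp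
      qed (intro borel_measurable_times e_M T_M)
      have cross: "(\<integral>w. T n w * e n w \<partial>M) = 0"
      proof -
        \<comment> \<open>The indicator inside \<open>e n\<close> is moved to the factor
          \<open>T n\<close>, so that \<open>d n\<close> meets an \<open>\<F> n\<close>-measurable
          function.\<close>
        have "(\<integral>w. (indicator (A n) w * T n w) * d n w \<partial>M) = 0"
        proof (rule d_orthogonal)
          have "T n \<in> borel_measurable (\<F> n)"
            unfolding T_def by (intro borel_measurable_sum measurable_\<F>_le[OF e_adapted]) auto
          then show "(\<lambda>w. indicator (A n) w * T n w) \<in> borel_measurable (\<F> n)"
            using A_sets by (intro borel_measurable_times borel_measurable_indicator) auto
          show "integrable M (\<lambda>w. (indicator (A n) w * T n w)\<^sup>2)"
          proof (rule Bochner_Integration.integrable_bound)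
            show "integrable M (\<lambda>w. (T n w)\<^sup>2)" using Suc by simp
            show "(\<lambda>w. (indicator (A n) w * T n w)\<^sup>2) \<in> borel_measurable M"
              using A_M by (intro borel_measurable_power borel_measurable_times borel_measurable_indicator T_M)
          qed (auto simp: indicator_def)
        qed
        then show ?thesis by (simp add: e_def ac_simps)
      qed
      have "(\<integral>w. (T (Suc n) w)\<^sup>2 \<partial>M) = (\<integral>w. (T n w)\<^sup>2 \<partial>M) + (\<integral>w. (e n w)\<^sup>2 \<partial>M)"
        unfolding expand using Suc e_int cross_int cross by simp
      also have "\<dots> \<le> (\<Sum>i=m..<n. \<integral>w. (d i w)\<^sup>2 \<partial>M) + (\<integral>w. (d n w)\<^sup>2 \<partial>M)"
        using Suc by (intro add_mono integral_mono e_int d_sq_integrable e_sq) auto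
      finally show ?thesis
        using Suc e_int cross_int True unfolding expand by simp
    qed
  qed
  have stop: "\<bar>T n w\<bar> \<ge> a" if w: "w \<in> space M" and ex: "\<exists>k\<in>{m..n}. \<bar>\<Sum>i=m..<k. d i w\<bar> \<ge> a" for w
  proof -
    \<comment> \<open>The first exceedance: increments of index below \<open>k\<close> survive and
      later ones vanish, so the stopped sum freezes at the exceeding value.\<close>
    define k where "k = (LEAST k. k \<in> {m..n} \<and> \<bar>\<Sum>i=m..<k. d i w\<bar> \<ge> a)"
    have k: "k \<in> {m..n} \<and> \<bar>\<Sum>i=m..<k. d i w\<bar> \<ge> a"
      unfolding k_def
      using LeastI_ex[of "\<lambda>k. k \<in> {m..n} \<and> \<bar>\<Sum>i=m..<k. d i w\<bar> \<ge> a"] ex by blast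
    have before: "\<bar>\<Sum>i=m..<j. d i w\<bar> < a" if "j < k" "m \<le> j" for j
      using not_less_Least[of j "\<lambda>k. k \<in> {m..n} \<and> \<bar>\<Sum>i=m..<k. d i w\<bar> \<ge> a"] that k
      unfolding k_def[symmetric] by force
    have "e j w = (if j < k then d j w else 0)" if "m \<le> j" "j < n" for j
    proof (cases "j < k")
      case True
      then have "w \<in> A j" using before w unfolding A_def by auto
      then show ?thesis using True by (simp add: e_def)
    next
      case False
      then have "w \<notin> A j" using k unfolding A_def by force
      then show ?thesis using False by (simp add: e_def)
    qed
    then have "T n w = (\<Sum>i=m..<n. if i < k then d i w else 0)"
      unfolding T_def by (intro sum.cong) auto
    also have "\<dots> = (\<Sum>i\<in>{m..<n} \<inter> {i. i < k}. d i w)"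
      by (simp add: sum.If_cases)
    also have "{m..<n} \<inter> {i. i < k} = {m..<k}" using k by auto
    finally show ?thesis using k by simp
  qed
  have "prob {w \<in> space M. \<exists>k\<in>{m..n}. \<bar>\<Sum>i=m..<k. d i w\<bar> \<ge> a} \<le> prob {w \<in> space M. a\<^sup>2 \<le> (T n w)\<^sup>2}"
    using stop a by (intro finite_measure_mono) (auto simp: abs_le_square_iff[symmetric])
  also have "\<dots> \<le> (\<integral>w. (T n w)\<^sup>2 \<partial>M) / a\<^sup>2"
    using T_main a by (intro integral_Markov_inequality_measure[of _ _ "space M"]) auto
  also have "\<dots> \<le> (\<Sum>i=m..<n. \<integral>w. (d i w)\<^sup>2 \<partial>M) / a\<^sup>2"
    using T_main a by (intro divide_right_mono) auto
  finally show ?thesis .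
qed

text \<open>The maximal inequality on a window starting at \<open>m\<close> does not depend on its
  length except through a tail of the variance series. As \<open>m\<close> grows the tail vanishes,
  so almost surely the sums eventually oscillate less than any given level.\<close>

lemma AE_Cauchy_sum: "AE w in M. Cauchy (\<lambda>n. \<Sum>i<n. d i w)"
proof -
  define E where "E i = (\<integral>w. (d i w)\<^sup>2 \<partial>M)" for i
  have E_nonneg: "E i \<ge> 0" for i by (simp add: E_def)
  have E_sum: "summable E" using d_summable unfolding E_def .
  have d_M [measurable]: "d j \<in> borel_measurable M" for j by (rule measurable_\<F>[OF d_adapted])
  have tail: "prob {w \<in> space M. \<exists>k\<ge>m. \<bar>\<Sum>i=m..<k. d i w\<bar> \<ge> a} \<le> (\<Sum>i. E (i + m)) / a\<^sup>2"
    if a: "a > 0" for m and a :: real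
  proof -
    define B where "B n = {w \<in> space M. \<exists>k\<in>{m..n}. \<bar>\<Sum>i=m..<k. d i w\<bar> \<ge> a}" for n
    have "(\<lambda>n. prob (B n)) \<longlonglongrightarrow> prob (\<Union>n. B n)"
      by (intro finite_Lim_measure_incseq) (auto simp: B_def incseq_def)
    moreover have "prob (B n) \<le> (\<Sum>i. E (i + m)) / a\<^sup>2" for n
    proof -
      have "(\<Sum>i=m..<n. E i) = (\<Sum>i<n - m. E (i + m))"
        by (rule sum.reindex_bij_witness[of _ "\<lambda>i. i + m" "\<lambda>i. i - m"]) auto
      also have "\<dots> \<le> (\<Sum>i. E (i + m))"
        using E_sum E_nonneg by (intro sum_le_suminf) (auto simp: summable_iff_shift)
      finally have "(\<Sum>i=m..<n. E i) / a\<^sup>2 \<le> (\<Sum>i. E (i + m)) / a\<^sup>2"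
        by (intro divide_right_mono) auto
      then show ?thesis
        using maximal_inequality[OF a, of m n] unfolding B_def E_def by linarith
    qed
    ultimately have "prob (\<Union>n. B n) \<le> (\<Sum>i. E (i + m)) / a\<^sup>2"
      by (intro LIMSEQ_le_const2) auto
    also have "(\<Union>n. B n) = {w \<in> space M. \<exists>k\<ge>m. \<bar>\<Sum>i=m..<k. d i w\<bar> \<ge> a}"
      by (auto simp: B_def) (meson atLeastAtMost_iff order_refl)
    finally show ?thesis .
  qed
  have level: "AE w in M. \<exists>m. \<forall>k\<ge>m. \<bar>\<Sum>i=m..<k. d i w\<bar> < a" if a: "a > 0" for a :: real
  proof -
    \<comment> \<open>The bad event lies inside the tail event for every \<open>m\<close>, and the
      probabilities of the latter tend to 0.\<close>
    define B where "B = {w \<in> space M. \<forall>m. \<exists>k\<ge>m. \<bar>\<Sum>i=m..<k. d i w\<bar> \<ge> a}"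
    have B_M: "B \<in> events" unfolding B_def by measurable
    have "(\<lambda>m. (\<Sum>i. E (i + m)) / a\<^sup>2) \<longlonglongrightarrow> 0 / a\<^sup>2"
      using suminf_exist_split2[OF E_sum] a by (intro tendsto_divide) auto
    moreover have "prob B \<le> (\<Sum>i. E (i + m)) / a\<^sup>2" for m
    proof -
      have "prob B \<le> prob {w \<in> space M. \<exists>k\<ge>m. \<bar>\<Sum>i=m..<k. d i w\<bar> \<ge> a}"
        by (intro finite_measure_mono) (auto simp: B_def)
      then show ?thesis using tail[OF a, of m] by linarith
    qed
    ultimately have "prob B \<le> 0"
      by (intro LIMSEQ_le_const[of "\<lambda>m. (\<Sum>i. E (i + m)) / a\<^sup>2"]) auto
    then have "prob B = 0" using measure_nonneg[of M B] by linarith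
    then have "B \<in> null_sets M" using B_M by (simp add: null_sets_def emeasure_eq_measure)
    then show ?thesis
      by (rule AE_I'[of B]) (auto simp: B_def not_less)
  qed
  \<comment> \<open>Countably many levels \<open>1 / (p + 1)\<close> suffice, so one null set serves
    them all.\<close>
  have "AE w in M. \<forall>p. \<exists>m. \<forall>k\<ge>m. \<bar>\<Sum>i=m..<k. d i w\<bar> < inverse (real (Suc p))"
    unfolding AE_all_countable by (intro allI level) auto
  then show ?thesis
  proof eventually_elim
    case (elim w)
    show ?case
    proof (rule metric_CauchyI)
      fix \<delta> :: real assume "\<delta> > 0"
      then obtain p where p: "inverse (real (Suc p)) < \<delta> / 2" using reals_Archimedean half_gt_zero by blast
      obtain m where m: "\<And>k. k \<ge> m \<Longrightarrow> \<bar>\<Sum>i=m..<k. d i w\<bar> < inverse (real (Suc p))" using elim by blast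
      have split: "(\<Sum>i<k. d i w) = (\<Sum>i<m. d i w) + (\<Sum>i=m..<k. d i w)" if "k \<ge> m" for k
        using that by (simp add: lessThan_atLeast0 sum.atLeastLessThan_concat)
      have "dist (\<Sum>i<k. d i w) (\<Sum>i<l. d i w) < \<delta>" if "k \<ge> m" "l \<ge> m" for k l
        using m[OF that(1)] m[OF that(2)] p unfolding split[OF that(1)] split[OF that(2)] dist_real_def by linarith
      then show "\<exists>N. \<forall>k\<ge>N. \<forall>l\<ge>N. dist (\<Sum>i<k. d i w) (\<Sum>i<l. d i w) < \<delta>" by blast
    qed
  qed
qed

end

subsection \<open>Stochastic gradient descent with drifting objectives\<close>

text \<open>Sum and integral commute for nonnegative functions, so the sum has finite integral and
  is finite almost everywhere.\<close>

lemma AE_summable_of_summable_integrals: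
  fixes q :: "nat \<Rightarrow> 'w \<Rightarrow> real"
  assumes q: "\<And>k. integrable M (q k)" and nonneg: "\<And>k w. q k w \<ge> 0"
    and sum: "summable (\<lambda>k. \<integral>w. q k w \<partial>M)"
  shows "AE w in M. summable (\<lambda>k. q k w)"
proof -
  have [measurable]: "q k \<in> borel_measurable M" for k using q by auto
  have "(\<integral>\<^sup>+w. (\<Sum>k. ennreal (q k w)) \<partial>M) = (\<Sum>k. \<integral>\<^sup>+w. ennreal (q k w) \<partial>M)"
    by (rule nn_integral_suminf) auto
  also have "\<dots> = (\<Sum>k. ennreal (\<integral>w. q k w \<partial>M))"
    using q nonneg by (simp add: nn_integral_eq_integral)
  also have "\<dots> = ennreal (\<Sum>k. \<integral>w. q k w \<partial>M)"
    using sum nonneg by (intro suminf_ennreal2) auto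
  finally have "(\<integral>\<^sup>+w. (\<Sum>k. ennreal (q k w)) \<partial>M) \<noteq> \<infinity>" by simp
  then have "AE w in M. (\<Sum>k. ennreal (q k w)) \<noteq> \<infinity>"
    by (intro nn_integral_PInf_AE) auto
  then show ?thesis
    by eventually_elim (use nonneg in \<open>auto intro: summable_suminf_not_top\<close>)
qed

lemma Cauchy_componentwise:
  fixes S :: "nat \<Rightarrow> 'a::euclidean_space"
  assumes "\<And>b. b \<in> Basis \<Longrightarrow> Cauchy (\<lambda>n. S n \<bullet> b)"
  shows "Cauchy S"
proof -
  have "(\<lambda>n. \<Sum>b\<in>Basis. (S n \<bullet> b) *\<^sub>R b) \<longlonglongrightarrow> (\<Sum>b\<in>Basis. lim (\<lambda>n. S n \<bullet> b) *\<^sub>R b)"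
    using assms by (intro tendsto_intros) (auto simp: Cauchy_convergent_iff convergent_LIMSEQ_iff)
  then show ?thesis by (auto simp: euclidean_representation intro: LIMSEQ_imp_Cauchy)
qed

lemma norm_sq_add_le: "(norm (x + y))\<^sup>2 \<le> 2 * (norm x)\<^sup>2 + 2 * (norm y)\<^sup>2"
  for x y :: "'a::real_normed_vector"
proof -
  have "(norm (x + y))\<^sup>2 \<le> (norm x + norm y)\<^sup>2"
    by (intro power_mono norm_triangle_ineq) auto
  also have "\<dots> \<le> 2 * (norm x)\<^sup>2 + 2 * (norm y)\<^sup>2"
    using sum_squares_bound[of "norm x" "norm y"] by (simp add: power2_sum)
  finally show ?thesis .
qed

text \<open>
  The noise \<open>n k\<close> is centred and has variance at most \<open>v\<close> conditionally on \<open>\<F> k\<close>; both are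
  expressed by testing against \<open>\<F> k\<close>-measurable functions.
\<close>

locale stochastic_gradient_descent = prob_space M for M :: "'w measure" +
  fixes \<F> :: "nat \<Rightarrow> 'w measure" and n x :: "nat \<Rightarrow> 'w \<Rightarrow> 'a::euclidean_space"
    and F :: "nat \<Rightarrow> 'a \<Rightarrow> real" and G :: "nat \<Rightarrow> 'a \<Rightarrow> 'a"
    and \<gamma> a :: "nat \<Rightarrow> real" and L \<kappa> v \<delta> :: real and x\<^sub>0 :: 'a
  assumes space_\<F>: "\<And>k. space (\<F> k) = space M"
    and \<F>_mono: "\<And>k. sets (\<F> k) \<subseteq> sets (\<F> (Suc k))"
    and \<F>_sub: "\<And>k. sets (\<F> k) \<subseteq> sets M"
    and x_adapted: "\<And>k. x k \<in> borel_measurable (\<F> k)"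
    and n_centred: "\<And>k U. U \<in> borel_measurable (\<F> k) \<Longrightarrow> integrable M (\<lambda>w. norm (U w)) \<Longrightarrow>
      (\<integral>w. U w \<bullet> n k w \<partial>M) = 0"
    and n_variance_integrable: "\<And>k (U :: 'w \<Rightarrow> real). U \<in> borel_measurable (\<F> k) \<Longrightarrow>
      integrable M (\<lambda>w. (U w)\<^sup>2) \<Longrightarrow> integrable M (\<lambda>w. (U w)\<^sup>2 * (norm (n k w))\<^sup>2)"
    and n_variance: "\<And>k (U :: 'w \<Rightarrow> real). U \<in> borel_measurable (\<F> k) \<Longrightarrow>
      integrable M (\<lambda>w. (U w)\<^sup>2) \<Longrightarrow> (\<integral>w. (U w)\<^sup>2 * (norm (n k w))\<^sup>2 \<partial>M) \<le> v * (\<integral>w. (U w)\<^sup>2 \<partial>M)"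
    and x_init: "\<And>w. w \<in> space M \<Longrightarrow> x 0 w = x\<^sub>0"
    and x_step: "\<And>k w. w \<in> space M \<Longrightarrow> x (Suc k) w = x k w - \<gamma> k *\<^sub>R (G k (x k w) + n k w)"
    and F_GDERIV: "\<And>k y. GDERIV (F k) y :> G k y"
    and G_lipschitz: "\<And>k. L-lipschitz_on UNIV (G k)"
    and F_coercive: "\<And>k y. \<kappa> * (1 + (norm y)\<^sup>2) \<le> F k y" and \<kappa>_pos: "\<kappa> > 0"
    and F_drift: "\<And>k y. F (Suc k) y \<le> (1 + a k) * F k y"
    and a_nonneg: "\<And>k. a k \<ge> 0" and a_summable: "summable a"
    and \<gamma>_pos: "\<And>k. \<gamma> k > 0" and \<gamma>_small: "\<And>k. L * \<gamma> k / 2 \<le> 1 - \<delta>" and \<delta>_pos: "\<delta> > 0"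
    and \<gamma>_square_summable: "summable (\<lambda>k. (\<gamma> k)\<^sup>2)"
begin

section \<open>Consequences of smoothness and coercivity of the objectives\<close>

lemma L_nonneg: "L \<ge> 0"
  using G_lipschitz by (rule lipschitz_on_nonneg)

lemma v_nonneg: "v \<ge> 0"
proof -
  have "(\<integral>w. (norm (n 0 w))\<^sup>2 \<partial>M) \<le> v"
    using n_variance[of "\<lambda>_. 1" 0] by (simp add: prob_space)
  moreover have "0 \<le> (\<integral>w. (norm (n 0 w))\<^sup>2 \<partial>M)" by simp
  ultimately show ?thesis by linarith
qed

lemma F_pos: "F k y > 0"
  using F_coercive[of y k] \<kappa>_pos by (smt (verit) mult_pos_pos zero_le_power2)

lemma G_sq_le_F: "(norm (G k y))\<^sup>2 \<le> 2 * (L + 1) * F k y"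
  using grad_norm_sq_le[OF F_GDERIV G_lipschitz, of 0 k y] F_pos by (simp add: less_imp_le)

text \<open>The descent lemma at the origin. It turns square integrability of an iterate into
  integrability of objective and squared gradient; the constants may depend on \<open>k\<close>, as
  no uniform bound is drawn from it.\<close>

lemma F_growth: "F k y \<le> F k 0 + (norm (G k 0))\<^sup>2 + (L + 1) * (norm y)\<^sup>2"
proof -
  have "F k y - F k 0 - G k 0 \<bullet> y \<le> L / 2 * (norm y)\<^sup>2"
    using abs_le_D1[OF lipschitz_grad_descent[OF F_GDERIV G_lipschitz, of k 0 y]] unfolding add_0 .
  moreover have "G k 0 \<bullet> y \<le> (norm (G k 0))\<^sup>2 + (norm y)\<^sup>2"
    using Cauchy_Schwarz_ineq2[of "G k 0" y] abs_mult_le_sum_squares[of "norm (G k 0)" "norm y"] by simp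
  moreover have "L / 2 * (norm y)\<^sup>2 \<le> L * (norm y)\<^sup>2"
    using L_nonneg by (intro mult_right_mono) auto
  ultimately show ?thesis unfolding distrib_right mult_1 by linarith
qed

section \<open>Measurability and square integrability along the trajectory\<close>

lemmas F_measurable [measurable] = GDERIV_borel_measurable[OF F_GDERIV]

lemmas G_measurable [measurable] = lipschitz_borel_measurable[OF G_lipschitz]

lemma measurable_\<F>_Suc: "U \<in> measurable (\<F> k) N \<Longrightarrow> U \<in> measurable (\<F> (Suc k)) N"
  using \<F>_mono[of k] by (auto simp: measurable_def space_\<F>)

lemma measurable_\<F>_M: "U \<in> measurable (\<F> k) N \<Longrightarrow> U \<in> measurable M N"
  using \<F>_sub[of k] by (auto simp: measurable_def space_\<F>)

text \<open>As \<open>\<gamma> k\<close> is positive, the noise can be recovered from two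
  consecutive iterates, and these are adapted.\<close>

lemma n_adapted: "n k \<in> borel_measurable (\<F> (Suc k))"
proof -
  note [measurable] = x_adapted[of "Suc k"] measurable_\<F>_Suc[OF x_adapted[of k]]
  have "(\<lambda>w. (1 / \<gamma> k) *\<^sub>R (x k w - x (Suc k) w) - G k (x k w)) \<in> borel_measurable (\<F> (Suc k))"
    by measurable
  then show ?thesis
    using \<gamma>_pos[of k]
    by (subst measurable_cong[where g = "\<lambda>w. (1 / \<gamma> k) *\<^sub>R (x k w - x (Suc k) w) - G k (x k w)"])
      (auto simp: space_\<F> x_step)
qed

lemma n_M [measurable]: "n k \<in> borel_measurable M"
  by (rule measurable_\<F>_M[OF n_adapted])

lemma x_M [measurable]: "x k \<in> borel_measurable M"
  by (rule measurable_\<F>_M[OF x_adapted])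

lemma G_x_adapted: "(\<lambda>w. G k (x k w)) \<in> borel_measurable (\<F> k)"
  by (rule measurable_compose[OF x_adapted G_measurable])

lemma n_sq_integrable: "integrable M (\<lambda>w. (norm (n k w))\<^sup>2)"
  using n_variance_integrable[of "\<lambda>_. 1" k] by simp

lemma n_sq_expectation: "(\<integral>w. (norm (n k w))\<^sup>2 \<partial>M) \<le> v"
  using n_variance[of "\<lambda>_. 1" k] by (simp add: prob_space)

text \<open>Stated conditionally because the induction for the iterates applies it at each
  step.\<close>

lemma G_x_sq_integrable_if:
  assumes "integrable M (\<lambda>w. (norm (x k w))\<^sup>2)"
  shows "integrable M (\<lambda>w. (norm (G k (x k w)))\<^sup>2)"
proof (rule Bochner_Integration.integrable_bound)
  show "integrable M (\<lambda>w. 2 * (L + 1) * (F k 0 + (norm (G k 0))\<^sup>2 + (L + 1) * (norm (x k w))\<^sup>2))"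
    using assms by (intro integrable_mult_right Bochner_Integration.integrable_add) auto
  have "(norm (G k y))\<^sup>2 \<le> 2 * (L + 1) * (F k 0 + (norm (G k 0))\<^sup>2 + (L + 1) * (norm y)\<^sup>2)" for y
    using L_nonneg by (intro order_trans[OF G_sq_le_F] mult_left_mono F_growth) auto
  then show "AE w in M. norm ((norm (G k (x k w)))\<^sup>2)
      \<le> norm (2 * (L + 1) * (F k 0 + (norm (G k 0))\<^sup>2 + (L + 1) * (norm (x k w))\<^sup>2))"
    by (intro AE_I2) (metis abs_ge_self order_trans power2_norm_eq_inner real_norm_def abs_of_nonneg zero_le_power2)
qed measurable

lemma x_sq_integrable: "integrable M (\<lambda>w. (norm (x k w))\<^sup>2)"
proof (induction k)
  case 0
  have "integrable M (\<lambda>w. (norm x\<^sub>0)\<^sup>2)" by simp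
  then show ?case by (subst Bochner_Integration.integrable_cong[OF refl]) (auto simp: x_init)
next
  case (Suc k)
  show ?case
  proof (rule Bochner_Integration.integrable_bound)
    show "integrable M (\<lambda>w. 2 * (norm (x k w))\<^sup>2
        + 2 * ((\<gamma> k)\<^sup>2 * (2 * (norm (G k (x k w)))\<^sup>2 + 2 * (norm (n k w))\<^sup>2)))"
      using Suc G_x_sq_integrable_if[OF Suc] n_sq_integrable
      by (intro Bochner_Integration.integrable_add integrable_mult_right)
    have "(norm (x (Suc k) w))\<^sup>2 \<le> 2 * (norm (x k w))\<^sup>2
        + 2 * ((\<gamma> k)\<^sup>2 * (2 * (norm (G k (x k w)))\<^sup>2 + 2 * (norm (n k w))\<^sup>2))" if "w \<in> space M" for w
    proof -
      have "(norm (x (Suc k) w))\<^sup>2 \<le> 2 * (norm (x k w))\<^sup>2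
          + 2 * (norm (- (\<gamma> k *\<^sub>R (G k (x k w) + n k w))))\<^sup>2"
        unfolding x_step[OF that] diff_conv_add_uminus by (rule norm_sq_add_le)
      also have "(norm (- (\<gamma> k *\<^sub>R (G k (x k w) + n k w))))\<^sup>2 = (\<gamma> k)\<^sup>2 * (norm (G k (x k w) + n k w))\<^sup>2"
        by (simp add: power_mult_distrib)
      finally show ?thesis
        using mult_left_mono[OF norm_sq_add_le[of "G k (x k w)" "n k w"], of "(\<gamma> k)\<^sup>2"] by simp
    qed
    then show "AE w in M. norm ((norm (x (Suc k) w))\<^sup>2) \<le> norm (2 * (norm (x k w))\<^sup>2
        + 2 * ((\<gamma> k)\<^sup>2 * (2 * (norm (G k (x k w)))\<^sup>2 + 2 * (norm (n k w))\<^sup>2)))"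
      by (intro AE_I2) (auto intro: order_trans)
  qed measurable
qed

lemmas G_x_sq_integrable = G_x_sq_integrable_if[OF x_sq_integrable]

lemma F_x_integrable: "integrable M (\<lambda>w. F k (x k w))"
proof (rule Bochner_Integration.integrable_bound)
  show "integrable M (\<lambda>w. F k 0 + (norm (G k 0))\<^sup>2 + (L + 1) * (norm (x k w))\<^sup>2)"
    using x_sq_integrable by (intro integrable_mult_right Bochner_Integration.integrable_add) auto
  show "AE w in M. norm (F k (x k w)) \<le> norm (F k 0 + (norm (G k 0))\<^sup>2 + (L + 1) * (norm (x k w))\<^sup>2)"
    using F_pos F_growth by (intro AE_I2) (smt (verit) real_norm_def)
qed measurable

text \<open>Dividing by \<open>P k\<close> absorbs the multiplicative drift of the objectives.\<close>

definition P :: "nat \<Rightarrow> real" where "P k = (\<Prod>j<k. 1 + a j)"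
definition V :: "nat \<Rightarrow> 'w \<Rightarrow> real" where "V k w = F k (x k w) / P k"
text \<open>The part of the descent expansion that is linear in the noise: the first-order term
  contributes \<open>- \<gamma> k\<close> and the quadratic remainder
  \<open>L * (\<gamma> k)\<^sup>2\<close>, both times the inner product of gradient and
  noise.\<close>

definition d :: "nat \<Rightarrow> 'w \<Rightarrow> real" where
  "d k w = ((\<gamma> k * (1 - L * \<gamma> k) / P k) *\<^sub>R G k (x k w)) \<bullet> n k w"
text \<open>The part quadratic in the noise. It is not divided by \<open>P k\<close>: since
  \<open>P k \<ge> 1\<close>, it bounds the rescaled term from above.\<close>

definition q :: "nat \<Rightarrow> 'w \<Rightarrow> real" where "q k w = L / 2 * ((\<gamma> k)\<^sup>2 * (norm (n k w))\<^sup>2)"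

section \<open>Pathwise one-step descent\<close>

lemma P_ge_1: "P k \<ge> 1"
  unfolding P_def using a_nonneg by (intro prod_ge_1) auto

lemma P_pos: "P k > 0"
  using P_ge_1[of k] by linarith

text \<open>Together with \<open>1 \<le> P k\<close> this makes \<open>V\<close> and
  \<open>F\<close> comparable uniformly in \<open>k\<close>.\<close>

lemma P_bounded: "P k \<le> exp (suminf a)"
proof -
  have "P k \<le> (\<Prod>j<k. exp (a j))"
    unfolding P_def using a_nonneg by (intro prod_mono) (auto simp: exp_ge_add_one_self intro: add_nonneg_nonneg)
  also have "\<dots> = exp (\<Sum>j<k. a j)" by (simp add: exp_sum)
  also have "\<dots> \<le> exp (suminf a)" using a_nonneg a_summable by (simp add: sum_le_suminf)
  finally show ?thesis .
qed

lemma V_nonneg: "V k w \<ge> 0"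
  using F_pos[of k "x k w"] P_ge_1[of k] by (simp add: V_def)

lemma q_nonneg: "q k w \<ge> 0"
  using L_nonneg by (simp add: q_def)

text \<open>The drift factor \<open>1 + a k\<close> cancels against \<open>P (Suc k)\<close>, which
  leaves the descent lemma for the fixed objective \<open>F k\<close>. The step size condition then
  retains the fraction \<open>\<delta>\<close> of the squared gradient.\<close>

lemma V_step:
  assumes w: "w \<in> space M"
  shows "V (Suc k) w + \<delta> / P k * (\<gamma> k * (norm (G k (x k w)))\<^sup>2) \<le> V k w - d k w + q k w"
proof -
  define g where "g = G k (x k w)"
  have P: "P k \<ge> 1" "1 + a k > 0" using P_ge_1 a_nonneg[of k] by auto
  have "V (Suc k) w \<le> (1 + a k) * F k (x (Suc k) w) / P (Suc k)"
    unfolding V_def using P_ge_1[of "Suc k"] by (intro divide_right_mono F_drift) auto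
  also have "\<dots> = F k (x (Suc k) w) / P k"
    using P by (simp add: P_def)
  finally have 1: "V (Suc k) w \<le> F k (x (Suc k) w) / P k" .
  have next_x: "x k w + (- \<gamma> k) *\<^sub>R (g + n k w) = x (Suc k) w"
    by (simp add: x_step[OF w] g_def)
  have linear: "g \<bullet> ((- \<gamma> k) *\<^sub>R (g + n k w)) = - \<gamma> k * (norm g)\<^sup>2 - \<gamma> k * (g \<bullet> n k w)"
    by (simp add: power2_norm_eq_inner inner_add_right algebra_simps)
  have quadratic: "(norm ((- \<gamma> k) *\<^sub>R (g + n k w)))\<^sup>2
      = (\<gamma> k)\<^sup>2 * ((norm g)\<^sup>2 + 2 * (g \<bullet> n k w) + (norm (n k w))\<^sup>2)"
    unfolding power2_norm_eq_inner
    by (simp add: power2_eq_square inner_add_left inner_add_right inner_commute algebra_simps)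
  have "F k (x (Suc k) w) \<le> F k (x k w) - \<gamma> k * (norm g)\<^sup>2 - \<gamma> k * (g \<bullet> n k w)
      + L / 2 * ((\<gamma> k)\<^sup>2 * ((norm g)\<^sup>2 + 2 * (g \<bullet> n k w) + (norm (n k w))\<^sup>2))"
    using abs_le_D1[OF lipschitz_grad_descent[OF F_GDERIV G_lipschitz,
        of k "x k w" "(- \<gamma> k) *\<^sub>R (g + n k w)"]]
    unfolding next_x g_def[symmetric] linear quadratic by linarith
  also have "\<dots> = F k (x k w) - (1 - L * \<gamma> k / 2) * (\<gamma> k * (norm g)\<^sup>2)
      - \<gamma> k * (1 - L * \<gamma> k) * (g \<bullet> n k w) + q k w"
    by (simp add: q_def field_simps power2_eq_square)
  also have "\<dots> \<le> F k (x k w) - \<delta> * (\<gamma> k * (norm g)\<^sup>2) - \<gamma> k * (1 - L * \<gamma> k) * (g \<bullet> n k w) + q k w"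
    using \<gamma>_small[of k] \<gamma>_pos[of k] by (intro add_right_mono diff_right_mono diff_left_mono mult_right_mono) auto
  finally have "F k (x (Suc k) w) / P k \<le> (F k (x k w) - \<delta> * (\<gamma> k * (norm g)\<^sup>2)
      - \<gamma> k * (1 - L * \<gamma> k) * (g \<bullet> n k w) + q k w) / P k"
    using P by (intro divide_right_mono) auto
  also have "\<dots> = V k w - \<delta> / P k * (\<gamma> k * (norm g)\<^sup>2) - d k w + q k w / P k"
    by (simp add: V_def d_def g_def add_divide_distrib diff_divide_distrib)
  also have "q k w / P k \<le> q k w"
    using divide_left_mono[OF P(1) q_nonneg[of k w]] P by simp
  finally show ?thesis using 1 by (simp add: g_def)
qed

section \<open>Moments of the noise terms and descent in expectation\<close>

lemma q_integrable: "integrable M (q k)"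
  unfolding q_def using n_sq_integrable by (intro integrable_mult_right)

lemma q_expectation: "(\<integral>w. q k w \<partial>M) \<le> L * v * (\<gamma> k)\<^sup>2"
proof -
  have "(\<integral>w. q k w \<partial>M) = L / 2 * ((\<gamma> k)\<^sup>2 * (\<integral>w. (norm (n k w))\<^sup>2 \<partial>M))"
    by (simp add: q_def)
  also have "\<dots> \<le> L * ((\<gamma> k)\<^sup>2 * v)"
    using L_nonneg n_sq_expectation by (intro mult_mono mult_left_mono) auto
  finally show ?thesis by (simp add: ac_simps)
qed

lemma q_summable: "AE w in M. summable (\<lambda>k. q k w)"
proof (rule AE_summable_of_summable_integrals[OF q_integrable q_nonneg])
  show "summable (\<lambda>k. \<integral>w. q k w \<partial>M)"
    by (rule summable_comparison_test'[OF summable_mult[OF \<gamma>_square_summable, of "L * v"]])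
      (use q_nonneg q_expectation in auto)
qed

text \<open>Vector weights reduce by Cauchy-Schwarz to the scalar weight \<open>norm (U w)\<close>,
  to which the variance assumptions apply.\<close>

lemma inner_noise_integrable:
  assumes U: "U \<in> borel_measurable (\<F> k)" and U2: "integrable M (\<lambda>w. (norm (U w))\<^sup>2)"
  shows "integrable M (\<lambda>w. (U w \<bullet> n k w)\<^sup>2)" "integrable M (\<lambda>w. U w \<bullet> n k w)"
    "(\<integral>w. (U w \<bullet> n k w)\<^sup>2 \<partial>M) \<le> v * (\<integral>w. (norm (U w))\<^sup>2 \<partial>M)" "(\<integral>w. U w \<bullet> n k w \<partial>M) = 0"
proof -
  note [measurable] = U measurable_\<F>_M[OF U]
  have norm_adapted: "(\<lambda>w. norm (U w)) \<in> borel_measurable (\<F> k)" by measurable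
  note var = n_variance_integrable[OF norm_adapted U2] n_variance[OF norm_adapted U2]
  have CS: "(U w \<bullet> n k w)\<^sup>2 \<le> (norm (U w))\<^sup>2 * (norm (n k w))\<^sup>2" for w
    using Cauchy_Schwarz_ineq[of "U w" "n k w"] by (simp add: power2_norm_eq_inner)
  show sq: "integrable M (\<lambda>w. (U w \<bullet> n k w)\<^sup>2)"
    using CS by (intro Bochner_Integration.integrable_bound[OF var(1)]) auto
  show "integrable M (\<lambda>w. U w \<bullet> n k w)"
    by (rule square_integrable_imp_integrable[OF _ sq]) measurable
  have "(\<integral>w. (U w \<bullet> n k w)\<^sup>2 \<partial>M) \<le> (\<integral>w. (norm (U w))\<^sup>2 * (norm (n k w))\<^sup>2 \<partial>M)"
    by (intro integral_mono sq var CS)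
  then show "(\<integral>w. (U w \<bullet> n k w)\<^sup>2 \<partial>M) \<le> v * (\<integral>w. (norm (U w))\<^sup>2 \<partial>M)" using var(2) by linarith
  have "integrable M (\<lambda>w. norm (U w))"
    by (rule square_integrable_imp_integrable[OF _ U2]) measurable
  then show "(\<integral>w. U w \<bullet> n k w \<partial>M) = 0" using U by (intro n_centred)
qed

lemma d_adapted_coefficient:
  "(\<lambda>w. (\<gamma> k * (1 - L * \<gamma> k) / P k) *\<^sub>R G k (x k w)) \<in> borel_measurable (\<F> k)"
  using G_x_adapted by measurable

lemma d_coefficient_sq_integrable:
  "integrable M (\<lambda>w. (norm ((\<gamma> k * (1 - L * \<gamma> k) / P k) *\<^sub>R G k (x k w)))\<^sup>2)"
  unfolding norm_scaleR power_mult_distrib by (intro integrable_mult_right G_x_sq_integrable)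

lemmas d_facts = inner_noise_integrable[OF d_adapted_coefficient d_coefficient_sq_integrable, folded d_def]

lemma V_integrable: "integrable M (V k)"
  unfolding V_def using F_x_integrable by simp

text \<open>Initial value plus total cost of the noise; the next lemma shows that it bounds the
  expectation of every \<open>V m\<close>.\<close>

definition B :: real where "B = F 0 x\<^sub>0 + L * v * (\<Sum>k. (\<gamma> k)\<^sup>2)"

text \<open>Integrating \<open>V_step\<close> removes the martingale term \<open>d k\<close>, and
  the remaining inequality telescopes. \<open>P 0 = 1\<close> is an empty product, so the start
  contributes \<open>F 0 x\<^sub>0\<close>.\<close>

lemma expected_descent:
  "(\<integral>w. V m w \<partial>M) + (\<Sum>k<m. \<delta> / P k * (\<gamma> k * (\<integral>w. (norm (G k (x k w)))\<^sup>2 \<partial>M))) \<le> B"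
proof -
  have step: "(\<integral>w. V (Suc k) w \<partial>M) + \<delta> / P k * (\<gamma> k * (\<integral>w. (norm (G k (x k w)))\<^sup>2 \<partial>M))
      \<le> (\<integral>w. V k w \<partial>M) + L * v * (\<gamma> k)\<^sup>2" for k
  proof -
    have "(\<integral>w. V (Suc k) w + \<delta> / P k * (\<gamma> k * (norm (G k (x k w)))\<^sup>2) \<partial>M) \<le> (\<integral>w. V k w - d k w + q k w \<partial>M)"
      using V_integrable G_x_sq_integrable d_facts(2) q_integrable V_step
      by (intro integral_mono Bochner_Integration.integrable_add Bochner_Integration.integrable_diff
          integrable_mult_right) auto
    then show ?thesis
      using V_integrable G_x_sq_integrable d_facts(2,4) q_integrable q_expectation[of k] by simp
  qed
  have "(\<integral>w. V m w \<partial>M) + (\<Sum>k<m. \<delta> / P k * (\<gamma> k * (\<integral>w. (norm (G k (x k w)))\<^sup>2 \<partial>M)))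
      \<le> (\<integral>w. V 0 w \<partial>M) + L * v * (\<Sum>k<m. (\<gamma> k)\<^sup>2)"
  proof (induction m)
    case (Suc m)
    then show ?case using step[of m] by (simp add: algebra_simps)
  qed simp
  also have "(\<integral>w. V 0 w \<partial>M) = (\<integral>w. F 0 x\<^sub>0 \<partial>M)"
    by (rule Bochner_Integration.integral_cong) (auto simp: V_def P_def x_init)
  also have "\<dots> = F 0 x\<^sub>0" by (simp add: prob_space)
  also have "L * v * (\<Sum>k<m. (\<gamma> k)\<^sup>2) \<le> L * v * (\<Sum>k. (\<gamma> k)\<^sup>2)"
    using L_nonneg v_nonneg \<gamma>_square_summable by (intro mult_left_mono sum_le_suminf) auto
  finally show ?thesis by (simp add: B_def)
qed

text \<open>The weights \<open>1 / P k\<close> are at least \<open>1 / exp (suminf a)\<close>, so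
  they can be pulled out of the sum. This bound is the source of the rate.\<close>

lemma expected_gradient_sum:
  "(\<Sum>k<m. \<gamma> k * (\<integral>w. (norm (G k (x k w)))\<^sup>2 \<partial>M)) \<le> exp (suminf a) * B / \<delta>"
proof -
  define E where "E k = \<gamma> k * (\<integral>w. (norm (G k (x k w)))\<^sup>2 \<partial>M)" for k
  have E: "E k \<ge> 0" for k using \<gamma>_pos[of k] by (simp add: E_def)
  have "\<delta> / exp (suminf a) * (\<Sum>k<m. E k) \<le> (\<Sum>k<m. \<delta> / P k * E k)"
    unfolding sum_distrib_left using E P_bounded P_ge_1 \<delta>_pos
    by (intro sum_mono mult_right_mono divide_left_mono) (auto simp: P_pos)
  also have "\<dots> \<le> (\<integral>w. V m w \<partial>M) + (\<Sum>k<m. \<delta> / P k * E k)"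
    using V_nonneg by (simp add: integral_nonneg_AE)
  also have "\<dots> \<le> B" using expected_descent[of m] by (simp add: E_def)
  finally show ?thesis using \<delta>_pos by (simp add: E_def field_simps)
qed

lemma gradient_sum_AE: "AE w in M. summable (\<lambda>k. \<gamma> k * (norm (G k (x k w)))\<^sup>2)"
proof (rule AE_summable_of_summable_integrals)
  show "integrable M (\<lambda>w. \<gamma> k * (norm (G k (x k w)))\<^sup>2)" for k
    using G_x_sq_integrable by (intro integrable_mult_right)
  show "0 \<le> \<gamma> k * (norm (G k (x k w)))\<^sup>2" for k w using \<gamma>_pos[of k] by simp
  show "summable (\<lambda>k. \<integral>w. \<gamma> k * (norm (G k (x k w)))\<^sup>2 \<partial>M)"
  proof (rule bounded_imp_summable)
    show "0 \<le> (\<integral>w. \<gamma> k * (norm (G k (x k w)))\<^sup>2 \<partial>M)" for k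
      using \<gamma>_pos[of k] by simp
    show "(\<Sum>k\<le>m. \<integral>w. \<gamma> k * (norm (G k (x k w)))\<^sup>2 \<partial>M) \<le> exp (suminf a) * B / \<delta>" for m
      using expected_gradient_sum[of "Suc m"] unfolding lessThan_Suc_atMost by simp
  qed
qed

text \<open>A bound for each \<open>k\<close> separately, without the weight
  \<open>\<gamma> k\<close>: the squared gradient is at most a multiple of \<open>F k\<close>, hence
  of \<open>V k\<close>. It makes the variances of \<open>d k\<close> summable.\<close>

lemma expected_G_sq: "(\<integral>w. (norm (G k (x k w)))\<^sup>2 \<partial>M) \<le> 2 * (L + 1) * (exp (suminf a) * B)"
proof -
  have "(\<integral>w. V k w \<partial>M) \<le> (\<integral>w. V k w \<partial>M) + (\<Sum>j<k. \<delta> / P j * (\<gamma> j * (\<integral>w. (norm (G j (x j w)))\<^sup>2 \<partial>M)))"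
    using \<delta>_pos P_ge_1 \<gamma>_pos
    by (auto intro!: sum_nonneg mult_nonneg_nonneg divide_nonneg_nonneg integral_nonneg_AE
        intro: less_imp_le order_trans[OF zero_le_one])
  then have VB: "(\<integral>w. V k w \<partial>M) \<le> B" using expected_descent[of k] by linarith
  have "F k (x k w) \<le> exp (suminf a) * V k w" for w
  proof -
    have "F k (x k w) = P k * V k w" using P_ge_1[of k] by (simp add: V_def)
    then show ?thesis using mult_right_mono[OF P_bounded V_nonneg, of k k w] by simp
  qed
  then have "(norm (G k (x k w)))\<^sup>2 \<le> 2 * (L + 1) * (exp (suminf a) * V k w)" for w
    using L_nonneg by (intro order_trans[OF G_sq_le_F] mult_left_mono) auto
  then have "(\<integral>w. (norm (G k (x k w)))\<^sup>2 \<partial>M) \<le> (\<integral>w. 2 * (L + 1) * (exp (suminf a) * V k w) \<partial>M)"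
    by (intro integral_mono G_x_sq_integrable integrable_mult_right V_integrable)
  also have "\<dots> \<le> 2 * (L + 1) * (exp (suminf a) * B)"
    using VB L_nonneg by (simp add: mult_left_mono)
  finally show ?thesis .
qed

section \<open>Almost sure convergence of the noise sums and boundedness of the iterates\<close>

lemma noise_sum_Cauchy:
  assumes U: "\<And>k. U k \<in> borel_measurable (\<F> k)"
    and U2: "\<And>k. integrable M (\<lambda>w. (norm (U k w))\<^sup>2)"
    and U_sum: "summable (\<lambda>k. \<integral>w. (norm (U k w))\<^sup>2 \<partial>M)"
  shows "AE w in M. Cauchy (\<lambda>m. \<Sum>k<m. U k w \<bullet> n k w)"
proof -
  note U_facts = inner_noise_integrable[OF U U2]
  interpret martingale_differences M \<F> "\<lambda>k w. U k w \<bullet> n k w"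
  proof unfold_locales
    show "(\<lambda>w. U k w \<bullet> n k w) \<in> borel_measurable (\<F> (Suc k))" for k
      using measurable_\<F>_Suc[OF U] n_adapted by (rule borel_measurable_inner)
    show "(\<integral>w. h w * (U k w \<bullet> n k w) \<partial>M) = 0"
      if h: "h \<in> borel_measurable (\<F> k)" and h2: "integrable M (\<lambda>w. (h w)\<^sup>2)" for k h
    proof -
      note [measurable] = h measurable_\<F>_M[OF h] U[of k] measurable_\<F>_M[OF U[of k]]
      \<comment> \<open>The test function is absorbed into the weight;
        \<open>h w *\<^sub>R U k w\<close> is integrable as a product of two square integrable
        factors.\<close>
      have "(\<integral>w. (h w *\<^sub>R U k w) \<bullet> n k w \<partial>M) = 0"
      proof (rule n_centred)
        show "integrable M (\<lambda>w. norm (h w *\<^sub>R U k w))"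
        proof (rule Bochner_Integration.integrable_bound)
          show "integrable M (\<lambda>w. (h w)\<^sup>2 + (norm (U k w))\<^sup>2)"
            using h2 U2 by (rule Bochner_Integration.integrable_add)
          show "AE w in M. norm (norm (h w *\<^sub>R U k w)) \<le> norm ((h w)\<^sup>2 + (norm (U k w))\<^sup>2)"
            using abs_mult_le_sum_squares[of "h _" "norm (U k _)"] by (intro AE_I2) (simp add: abs_mult)
        qed measurable
      qed measurable
      then show ?thesis by simp
    qed
    show "summable (\<lambda>k. \<integral>w. (U k w \<bullet> n k w)\<^sup>2 \<partial>M)"
      by (rule summable_comparison_test'[OF summable_mult[OF U_sum, of v]]) (use U_facts(3) in simp)
  qed (use space_\<F> \<F>_mono \<F>_sub U_facts in auto)
  show ?thesis by (rule AE_Cauchy_sum)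
qed

lemma weighted_noise_AE: "AE w in M. Cauchy (\<lambda>m. \<Sum>k<m. \<gamma> k *\<^sub>R n k w)"
proof -
  \<comment> \<open>The deterministic weights \<open>\<gamma> k *\<^sub>R b\<close> have squared
    norms \<open>(\<gamma> k)\<^sup>2\<close>, which are summable, and the finitely many coordinates
    share one null set.\<close>
  have "AE w in M. \<forall>b\<in>Basis. Cauchy (\<lambda>m. \<Sum>k<m. (\<gamma> k *\<^sub>R b) \<bullet> n k w)"
  proof (rule AE_finite_allI)
    fix b :: 'a assume "b \<in> Basis"
    then show "AE w in M. Cauchy (\<lambda>m. \<Sum>k<m. (\<gamma> k *\<^sub>R b) \<bullet> n k w)"
      using \<gamma>_square_summable by (intro noise_sum_Cauchy) (auto simp: prob_space)
  qed simp
  then show ?thesis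
  proof eventually_elim
    case (elim w)
    show ?case
      by (rule Cauchy_componentwise) (use elim in \<open>simp add: inner_sum_left inner_sum_right inner_commute\<close>)
  qed
qed

lemma d_sum_AE: "AE w in M. Cauchy (\<lambda>m. \<Sum>k<m. d k w)"
  unfolding d_def
proof (rule noise_sum_Cauchy[OF d_adapted_coefficient d_coefficient_sq_integrable])
  define C where "C = 2 * (L + 1) * (exp (suminf a) * B)"
  show "summable (\<lambda>k. \<integral>w. (norm ((\<gamma> k * (1 - L * \<gamma> k) / P k) *\<^sub>R G k (x k w)))\<^sup>2 \<partial>M)"
  proof (rule summable_comparison_test'[OF summable_mult[OF \<gamma>_square_summable, of C]])
    fix k
    \<comment> \<open>\<open>L * \<gamma> k\<close> lies between 0 and 2 by
      \<open>\<gamma>_small\<close> and \<open>\<delta>_pos\<close>, so this factor cannot enlarge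
      the coefficient.\<close>
    have "\<bar>1 - L * \<gamma> k\<bar> \<le> 1"
      using \<gamma>_small[of k] \<delta>_pos \<gamma>_pos[of k] L_nonneg by (auto simp: abs_le_iff mult_nonneg_nonneg less_imp_le)
    then have "\<bar>1 - L * \<gamma> k\<bar> * \<gamma> k \<le> 1 * \<gamma> k"
      using \<gamma>_pos[of k] by (intro mult_right_mono) auto
    also have "\<dots> \<le> P k * \<gamma> k" using P_ge_1[of k] \<gamma>_pos[of k] by (intro mult_right_mono) auto
    finally have "\<bar>\<gamma> k * (1 - L * \<gamma> k) / P k\<bar> \<le> \<bar>\<gamma> k\<bar>"
      using P_ge_1[of k] \<gamma>_pos[of k] by (simp add: abs_mult pos_divide_le_eq mult.commute)
    then have coef: "(\<gamma> k * (1 - L * \<gamma> k) / P k)\<^sup>2 \<le> (\<gamma> k)\<^sup>2" by (simp only: abs_le_square_iff)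
    have "(\<integral>w. (norm ((\<gamma> k * (1 - L * \<gamma> k) / P k) *\<^sub>R G k (x k w)))\<^sup>2 \<partial>M)
        = (\<gamma> k * (1 - L * \<gamma> k) / P k)\<^sup>2 * (\<integral>w. (norm (G k (x k w)))\<^sup>2 \<partial>M)"
      by (simp add: power_mult_distrib power_divide)
    also have "\<dots> \<le> (\<gamma> k)\<^sup>2 * C"
      unfolding C_def using coef expected_G_sq by (intro mult_mono) (auto simp: integral_nonneg_AE)
    finally show "norm (\<integral>w. (norm ((\<gamma> k * (1 - L * \<gamma> k) / P k) *\<^sub>R G k (x k w)))\<^sup>2 \<partial>M) \<le> C * (\<gamma> k)\<^sup>2"
      by (simp add: mult.commute integral_nonneg_AE)
  qed
qed

text \<open>Summing \<open>V_step\<close> along a path, the martingale part is bounded because it is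
  Cauchy and the sum of \<open>q\<close> converges. Hence \<open>V\<close> is bounded, and
  coercivity passes this to the iterates.\<close>

lemma bounded_AE: "AE w in M. bounded (range (\<lambda>k. x k w))"
  using d_sum_AE q_summable AE_space
proof eventually_elim
  case (elim w)
  obtain C where C: "\<And>m. \<bar>\<Sum>k<m. d k w\<bar> \<le> C"
    using Cauchy_Bseq[OF elim(1)] unfolding Bseq_def by auto
  have V_sum: "V m w \<le> V 0 w - (\<Sum>k<m. d k w) + (\<Sum>k<m. q k w)" for m
  proof (induction m)
    case (Suc m)
    have "\<delta> / P m * (\<gamma> m * (norm (G m (x m w)))\<^sup>2) \<ge> 0"
      using \<delta>_pos P_ge_1[of m] \<gamma>_pos[of m] by (intro mult_nonneg_nonneg) auto
    then show ?case using Suc V_step[OF elim(3), of m] by simp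
  qed simp
  define R where "R = exp (suminf a) * (V 0 w + C + (\<Sum>k. q k w)) / \<kappa>"
  have bound: "(norm (x m w))\<^sup>2 \<le> R" for m
  proof -
    have "(\<Sum>k<m. q k w) \<le> (\<Sum>k. q k w)" by (rule sum_le_suminf[OF elim(2)]) (auto simp: q_nonneg)
    then have V: "V m w \<le> V 0 w + C + (\<Sum>k. q k w)" using V_sum[of m] C[of m] by linarith
    have "\<kappa> * (norm (x m w))\<^sup>2 \<le> F m (x m w)"
      using F_coercive[of "x m w" m] \<kappa>_pos by (simp add: distrib_left)
    also have "\<dots> = P m * V m w" using P_ge_1[of m] by (simp add: V_def)
    also have "\<dots> \<le> exp (suminf a) * (V 0 w + C + (\<Sum>k. q k w))"
      using P_bounded V V_nonneg[of m w] by (intro mult_mono) auto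
    finally show ?thesis using \<kappa>_pos by (simp add: R_def pos_le_divide_eq mult.commute)
  qed
  have "norm (x m w) \<le> sqrt R" for m by (rule real_le_rsqrt[OF bound])
  then show ?case by (auto simp: bounded_iff)
qed

end

subsection \<open>Deterministic convergence\<close>

text \<open>Since the step sizes have infinite sum, \<open>u\<close> must drop below any threshold
  \<eta>. While it stays above \<eta>, \<open>norm (u k)\<close> is at most
  \<open>(norm (u k))\<^sup>2 / \<eta>\<close>, so the summable series limits how far
  \<open>x\<close> can move, and the Lipschitz bound limits how far \<open>u\<close> can climb. The
  null sequence \<open>r\<close> accounts for \<open>u\<close> being gradients of varying
  objectives.\<close>

lemma sgd_deterministic_convergence:
  fixes x u \<xi> :: "nat \<Rightarrow> 'a::real_normed_vector"
  assumes step: "\<And>k. x (Suc k) = x k - \<gamma> k *\<^sub>R (u k + \<xi> k)"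
    and \<gamma>_pos: "\<And>k. \<gamma> k > 0" and \<gamma>_div: "filterlim (\<lambda>n. \<Sum>k<n. \<gamma> k) at_top sequentially"
    and \<gamma>_0: "\<gamma> \<longlonglongrightarrow> 0"
    and u_sum: "summable (\<lambda>k. \<gamma> k * (norm (u k))\<^sup>2)"
    and noise: "Cauchy (\<lambda>n. \<Sum>k<n. \<gamma> k *\<^sub>R \<xi> k)"
    and lip: "\<And>m n. norm (u n - u m) \<le> L * norm (x n - x m) + r n + r m" and L: "L \<ge> 0"
    and r: "r \<longlonglongrightarrow> 0"
  shows "u \<longlonglongrightarrow> 0" "(\<lambda>k. norm (x (Suc k) - x k)) \<longlonglongrightarrow> 0"
proof -
  define S where "S n = (\<Sum>k<n. \<gamma> k *\<^sub>R \<xi> k)" for n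
  define T where "T n = (\<Sum>k<n. \<gamma> k * (norm (u k))\<^sup>2)" for n
  have dx: "norm (x n - x m) \<le> (\<Sum>k=m..<n. \<gamma> k * norm (u k)) + norm (S n - S m)" if "m \<le> n" for m n
  proof -
    have "x n - x m = - (\<Sum>k=m..<n. \<gamma> k *\<^sub>R u k) - (S n - S m)"
      using that by (induction n rule: dec_induct) (auto simp: step S_def algebra_simps)
    then have "norm (x n - x m) \<le> norm (\<Sum>k=m..<n. \<gamma> k *\<^sub>R u k) + norm (S n - S m)"
      by (metis norm_minus_cancel norm_triangle_ineq4)
    also have "norm (\<Sum>k=m..<n. \<gamma> k *\<^sub>R u k) \<le> (\<Sum>k=m..<n. \<gamma> k * norm (u k))"
      using \<gamma>_pos by (intro sum_norm_le) (auto simp: less_imp_le)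
    finally show ?thesis by simp
  qed
  show u: "u \<longlonglongrightarrow> 0"
  proof (rule LIMSEQ_I)
    fix e :: real assume "0 < e"
    \<comment> \<open>The argument ends with \<open>norm (u n) < 2 * \<eta>\<close>.\<close>
    define \<eta> where "\<eta> = e / 2"
    have \<eta>: "\<eta> > 0" using \<open>0 < e\<close> by (simp add: \<eta>_def)
    \<comment> \<open>The admissible displacement of \<open>x\<close> during an excursion. The
      \<open>+ 1\<close> makes both \<open>\<delta>\<close> and \<open>L * \<delta>\<close> at most
      a quarter of \<open>\<eta>\<close>, also for \<open>L = 0\<close>.\<close>
    define \<delta> where "\<delta> = \<eta> / (4 * (L + 1))"
    have \<delta>: "\<delta> > 0" "L * \<delta> \<le> \<eta> / 4" "\<delta> \<le> \<eta> / 4"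
      using \<eta> L by (auto simp: \<delta>_def field_simps)
    obtain N1 where N1: "\<And>m n. m \<ge> N1 \<Longrightarrow> n \<ge> N1 \<Longrightarrow> norm (S m - S n) < \<delta> / 4"
      using CauchyD[OF noise, of "\<delta> / 4"] \<delta> unfolding S_def by auto
    have "Cauchy T" unfolding T_def
      using u_sum by (simp add: summable_iff_convergent convergent_Cauchy)
    then obtain N2 where N2: "\<And>m n. m \<ge> N2 \<Longrightarrow> n \<ge> N2 \<Longrightarrow> norm (T m - T n) < \<eta> * \<delta> / 4"
      using CauchyD[of T "\<eta> * \<delta> / 4"] \<delta> \<eta> by auto
    obtain N3 where N3: "\<And>n. n \<ge> N3 \<Longrightarrow> norm (r n - 0) < \<delta>"
      using LIMSEQ_D[OF r \<delta>(1)] by auto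
    obtain N4 where N4: "\<And>n. n \<ge> N4 \<Longrightarrow> norm (\<gamma> n - 0) < \<delta> / (4 * \<eta>)"
      using LIMSEQ_D[OF \<gamma>_0, of "\<delta> / (4 * \<eta>)"] \<delta> \<eta> by auto
    define N where "N = Max {N1, N2, N3, N4}"
    have N: "N1 \<le> N" "N2 \<le> N" "N3 \<le> N" "N4 \<le> N" by (auto simp: N_def)
    \<comment> \<open>Otherwise the sum of \<open>\<gamma>\<close> would be bounded by that of
      \<open>\<gamma> k * (norm (u k))\<^sup>2 / \<eta>\<^sup>2\<close>, up to a finite initial
      part.\<close>
    have "\<exists>m\<ge>N. norm (u m) < \<eta>"
    proof (rule ccontr)
      assume "\<not> ?thesis"
      then have big: "norm (u m) \<ge> \<eta>" if "m \<ge> N" for m using that by force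
      have bound: "(\<Sum>k<n. \<gamma> k) \<le> (\<Sum>k<N. \<gamma> k) + (\<Sum>k. \<gamma> k * (norm (u k))\<^sup>2) / \<eta>\<^sup>2" for n
      proof -
        have "(\<Sum>k<n. \<gamma> k) \<le> (\<Sum>k\<in>{..<N} \<union> {N..<n}. \<gamma> k)"
          using \<gamma>_pos by (intro sum_mono2) (auto simp: less_imp_le)
        also have "\<dots> = (\<Sum>k<N. \<gamma> k) + (\<Sum>k=N..<n. \<gamma> k)"
          by (intro sum.union_disjoint) auto
        also have "(\<Sum>k=N..<n. \<gamma> k) \<le> (\<Sum>k=N..<n. \<gamma> k * (norm (u k))\<^sup>2 / \<eta>\<^sup>2)"
        proof (rule sum_mono)
          fix k assume "k \<in> {N..<n}"
          then have "\<eta>\<^sup>2 \<le> (norm (u k))\<^sup>2" using big \<eta> by (intro power_mono) auto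
          then have "\<gamma> k * \<eta>\<^sup>2 \<le> \<gamma> k * (norm (u k))\<^sup>2"
            using \<gamma>_pos[of k] by (intro mult_left_mono) auto
          then show "\<gamma> k \<le> \<gamma> k * (norm (u k))\<^sup>2 / \<eta>\<^sup>2" using \<eta> by (simp add: field_simps)
        qed
        also have "\<dots> = (\<Sum>k=N..<n. \<gamma> k * (norm (u k))\<^sup>2) / \<eta>\<^sup>2"
          by (simp add: sum_divide_distrib)
        also have "\<dots> \<le> (\<Sum>k. \<gamma> k * (norm (u k))\<^sup>2) / \<eta>\<^sup>2"
          using \<gamma>_pos by (intro divide_right_mono sum_le_suminf u_sum) (auto simp: less_imp_le)
        finally show ?thesis by simp
      qed
      obtain n where "(\<Sum>k<N. \<gamma> k) + (\<Sum>k. \<gamma> k * (norm (u k))\<^sup>2) / \<eta>\<^sup>2 + 1 \<le> (\<Sum>k<n. \<gamma> k)"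
        using \<gamma>_div unfolding filterlim_at_top eventually_sequentially by blast
      then show False using bound[of n] by linarith
    qed
    then obtain m0 where m0: "m0 \<ge> N" "norm (u m0) < \<eta>" by auto
    have "norm (u n - 0) < e" if n: "n \<ge> m0" for n
    proof -
      \<comment> \<open>The last index up to \<open>n\<close> below the threshold; from
        \<open>Suc m\<close> to \<open>n\<close> the sequence stays at or above it.\<close>
      define m where "m = (GREATEST m. m \<le> n \<and> norm (u m) < \<eta>)"
      have m: "m \<le> n \<and> norm (u m) < \<eta>"
        unfolding m_def by (rule GreatestI_nat[of _ m0 n]) (use m0 n in auto)
      have m_max: "k \<le> m" if "k \<le> n" "norm (u k) < \<eta>" for k
        unfolding m_def by (rule Greatest_le_nat[of _ _ n]) (use that in auto)
      have "m \<ge> N" using m_max[of m0] m0 n by simp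
      have "(\<Sum>k=m..<n. \<gamma> k * norm (u k)) \<le> \<delta> / 4 + \<delta> / 4"
      proof (cases "m < n")
        case True
        \<comment> \<open>The term at \<open>m\<close> is split off because \<open>u m\<close> is
          below the threshold; it is small because \<open>\<gamma> m\<close> is. The trade against
          the squares starts at \<open>Suc m\<close>.\<close>
        have "(\<Sum>k=m..<n. \<gamma> k * norm (u k)) = \<gamma> m * norm (u m) + (\<Sum>k=Suc m..<n. \<gamma> k * norm (u k))"
          using True by (rule sum.atLeast_Suc_lessThan)
        also have "\<gamma> m * norm (u m) \<le> \<delta> / (4 * \<eta>) * \<eta>"
          using N4[of m] m \<open>m \<ge> N\<close> N \<gamma>_pos[of m] \<eta> \<delta> by (intro mult_mono) auto
        also have "\<delta> / (4 * \<eta>) * \<eta> = \<delta> / 4" using \<eta> by simp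
        also have "(\<Sum>k=Suc m..<n. \<gamma> k * norm (u k)) \<le> (\<Sum>k=Suc m..<n. \<gamma> k * (norm (u k))\<^sup>2 / \<eta>)"
        proof (rule sum_mono)
          fix k assume "k \<in> {Suc m..<n}"
          then have "\<eta> \<le> norm (u k)" using m_max[of k] by force
          then have "norm (u k) * \<eta> \<le> norm (u k) * norm (u k)" by (intro mult_left_mono) auto
          then have "\<gamma> k * (norm (u k) * \<eta>) \<le> \<gamma> k * (norm (u k) * norm (u k))"
            by (rule mult_left_mono) (simp add: less_imp_le \<gamma>_pos)
          then show "\<gamma> k * norm (u k) \<le> \<gamma> k * (norm (u k))\<^sup>2 / \<eta>"
            unfolding pos_le_divide_eq[OF \<eta>] power2_eq_square mult.assoc .
        qed
        also have "\<dots> = (T n - T (Suc m)) / \<eta>"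
          using True sum_diff_nat_ivl[of 0 "Suc m" n "\<lambda>k. \<gamma> k * (norm (u k))\<^sup>2"]
          by (simp add: T_def sum_divide_distrib[symmetric] lessThan_atLeast0)
        also have "\<dots> \<le> \<delta> / 4"
        proof -
          have "T n - T (Suc m) \<le> \<delta> / 4 * \<eta>"
            using abs_le_D1[OF less_imp_le, OF N2[of n "Suc m", unfolded real_norm_def]] True \<open>m \<ge> N\<close> N
            by (simp add: mult.commute)
          then show ?thesis using \<eta> by (simp add: pos_divide_le_eq)
        qed
        finally show ?thesis by simp
      qed (use \<delta> m in auto)
      then have "norm (x n - x m) \<le> \<delta>"
        using dx[of m n] m N1[of n m] \<open>m \<ge> N\<close> N \<delta> by auto
      then have "L * norm (x n - x m) \<le> \<eta> / 4"
        using mult_left_mono[of _ \<delta> L] L \<delta> by (meson order_trans)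
      then have "norm (u n - u m) < \<eta> / 4 + \<eta> / 4 + \<eta> / 4"
        using lip[of n m] N3[of n] N3[of m] m \<open>m \<ge> N\<close> N \<delta> by auto
      then have "norm (u n) < 2 * \<eta>"
        using norm_triangle_ineq2[of "u n" "u m"] m \<eta> by linarith
      then show ?thesis by (simp add: \<eta>_def)
    qed
    then show "\<exists>no. \<forall>n\<ge>no. norm (u n - 0) < e" by blast
  qed
  have "(\<lambda>k. \<gamma> k *\<^sub>R u k + (S (Suc k) - S k)) \<longlonglongrightarrow> 0 *\<^sub>R 0 + 0"
  proof (intro tendsto_intros \<gamma>_0 u)
    show "(\<lambda>k. S (Suc k) - S k) \<longlonglongrightarrow> 0"
    proof (rule LIMSEQ_I)
      fix e :: real assume "e > 0"
      then obtain N where "\<forall>m\<ge>N. \<forall>n\<ge>N. norm (S m - S n) < e"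
        using CauchyD[OF noise] unfolding S_def by blast
      then show "\<exists>no. \<forall>n\<ge>no. norm (S (Suc n) - S n - 0) < e"
        by (auto intro!: exI[of _ N])
    qed
  qed
  then have "(\<lambda>k. norm (\<gamma> k *\<^sub>R u k + (S (Suc k) - S k))) \<longlonglongrightarrow> 0"
    by (simp add: tendsto_norm_zero)
  then show "(\<lambda>k. norm (x (Suc k) - x k)) \<longlonglongrightarrow> 0"
    by (simp add: step S_def scaleR_add_right norm_minus_commute add.commute)
qed

text \<open>On the compact set \<open>closure (range x) \<inter> A\<close> the norm of
  \<open>\<phi>\<close> attains a positive minimum, and the sequence eventually has smaller
  values.\<close>

lemma eventually_avoids_closed:
  fixes x :: "nat \<Rightarrow> 'a::euclidean_space" and \<phi> :: "'a \<Rightarrow> 'b::real_normed_vector"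
  assumes x: "bounded (range x)" and A: "closed A" and \<phi>: "continuous_on UNIV \<phi>"
    and lim: "(\<lambda>k. \<phi> (x k)) \<longlonglongrightarrow> 0" and nz: "\<And>y. y \<in> A \<Longrightarrow> \<phi> y \<noteq> 0"
  shows "\<forall>\<^sub>F k in sequentially. x k \<notin> A"
proof (cases "closure (range x) \<inter> A = {}")
  case True
  then have "x k \<notin> A" for k using closure_subset[of "range x"] by auto
  then show ?thesis by simp
next
  case False
  have "compact (closure (range x) \<inter> A)"
    using x A by (simp add: compact_Int_closed)
  moreover have "continuous_on (closure (range x) \<inter> A) (\<lambda>y. norm (\<phi> y))"
    using \<phi> by (intro continuous_on_norm) (rule continuous_on_subset, auto)
  ultimately obtain y where y: "y \<in> A"
      "\<And>z. z \<in> closure (range x) \<inter> A \<Longrightarrow> norm (\<phi> y) \<le> norm (\<phi> z)"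
    using continuous_attains_inf[OF _ False] by blast
  have "\<forall>\<^sub>F k in sequentially. norm (\<phi> (x k)) < norm (\<phi> y)"
    using order_tendstoD(2)[OF tendsto_norm_zero[OF lim], of "norm (\<phi> y)"] nz[OF y(1)] by simp
  then show ?thesis
    by eventually_elim (use y(2) closure_subset[of "range x"] in force)
qed

text \<open>The first two claims apply the avoidance lemma to the whole space and to the points at
  distance at least \<open>e\<close> from \<open>C\<close>. Nonemptiness keeps the distance claim
  meaningful, as \<open>infdist\<close> to the empty set is 0.\<close>

lemma bounded_vanishing_limit_points:
  fixes x :: "nat \<Rightarrow> 'a::euclidean_space" and \<phi> :: "'a \<Rightarrow> 'b::real_normed_vector"
  assumes x: "bounded (range x)" and \<phi>: "continuous_on UNIV \<phi>" and lim: "(\<lambda>k. \<phi> (x k)) \<longlonglongrightarrow> 0"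
  defines "C \<equiv> {y. \<phi> y = 0}"
  shows "C \<noteq> {}" and "(\<lambda>k. infdist (x k) C) \<longlonglongrightarrow> 0"
    and "strict_mono r \<Longrightarrow> (\<lambda>n. x (r n)) \<longlonglongrightarrow> l \<Longrightarrow> l \<in> C"
proof -
  show "C \<noteq> {}"
  proof
    assume "C = {}"
    then have "\<forall>\<^sub>F k in sequentially. x k \<notin> UNIV"
      by (intro eventually_avoids_closed[OF x _ \<phi> lim]) (auto simp: C_def)
    then show False by simp
  qed
  show "(\<lambda>k. infdist (x k) C) \<longlonglongrightarrow> 0"
  proof (rule tendstoI)
    fix e :: real assume e: "e > 0"
    have "\<forall>\<^sub>F k in sequentially. x k \<notin> {y. e \<le> infdist y C}"
    proof (rule eventually_avoids_closed[OF x _ \<phi> lim])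
      show "closed {y. e \<le> infdist y C}"
        by (intro closed_Collect_le continuous_on_const continuous_on_infdist continuous_on_id)
      show "\<phi> y \<noteq> 0" if "y \<in> {y. e \<le> infdist y C}" for y
        using that e infdist_zero[of y C] by (auto simp: C_def)
    qed
    then show "\<forall>\<^sub>F k in sequentially. dist (infdist (x k) C) 0 < e"
      by eventually_elim (simp add: infdist_nonneg)
  qed
  assume r: "strict_mono r" "(\<lambda>n. x (r n)) \<longlonglongrightarrow> l"
  have "isCont \<phi> l" using \<phi> by (simp add: continuous_on_eq_continuous_at)
  then have "(\<lambda>n. \<phi> (x (r n))) \<longlonglongrightarrow> \<phi> l" using r(2) by (rule isCont_tendsto_compose)
  moreover have "(\<lambda>n. \<phi> (x (r n))) \<longlonglongrightarrow> 0"
    using LIMSEQ_subseq_LIMSEQ[OF lim r(1)] by (simp add: comp_def)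
  ultimately show "l \<in> C" using LIMSEQ_unique by (auto simp: C_def)
qed

subsection \<open>Gaussian smoothing\<close>

locale smooth_function =
  fixes h :: "'a::euclidean_space \<Rightarrow> real" and H :: "'a \<Rightarrow> 'a" and L :: real
  assumes h_GDERIV: "\<And>y. GDERIV h y :> H y" and H_lipschitz: "L-lipschitz_on UNIV H"
begin

lemma L_nonneg: "L \<ge> 0"
  using H_lipschitz by (rule lipschitz_on_nonneg)

lemmas [measurable] = GDERIV_borel_measurable[OF h_GDERIV] lipschitz_borel_measurable[OF H_lipschitz]

lemma H_diff_le: "norm (H y - H y') \<le> L * norm (y - y')"
  using lipschitz_on_normD[OF H_lipschitz] by simp

lemma H_shift_le: "norm (H (y + s *\<^sub>R z) - H y) \<le> L * \<bar>s\<bar> * norm z"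
  using H_diff_le[of "y + s *\<^sub>R z" y] by simp

lemma integrable_grad_gaussian: "integrable std_gaussian (\<lambda>z. H (y + s *\<^sub>R z))"
proof -
  interpret prob_space "std_gaussian :: 'a measure" by (rule prob_space_std_gaussian)
  show ?thesis
  proof (rule Bochner_Integration.integrable_bound)
    show "integrable std_gaussian (\<lambda>z :: 'a. norm (H y) + L * \<bar>s\<bar> * norm z)"
      by (intro Bochner_Integration.integrable_add integrable_mult_right integrable_const
          integrable_std_gaussian_norm)
    have "norm (H (y + s *\<^sub>R z)) \<le> norm (H y) + L * \<bar>s\<bar> * norm z" for z
      using H_shift_le[of y s z] norm_triangle_ineq2[of "H (y + s *\<^sub>R z)" "H y"] by linarith
    then show "AE z in std_gaussian. norm (H (y + s *\<^sub>R z)) \<le> norm (norm (H y) + L * \<bar>s\<bar> * norm z)"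
      by (intro AE_I2) (metis abs_ge_self order_trans real_norm_def)
  qed measurable
qed

lemma integrable_gaussian: "integrable std_gaussian (\<lambda>z. h (y + s *\<^sub>R z))"
proof -
  interpret prob_space "std_gaussian :: 'a measure" by (rule prob_space_std_gaussian)
  show ?thesis
  proof (rule Bochner_Integration.integrable_bound)
    show "integrable std_gaussian (\<lambda>z :: 'a. \<bar>h y\<bar> + norm (H y) * \<bar>s\<bar> * norm z + L / 2 * s\<^sup>2 * (norm z)\<^sup>2)"
      by (intro Bochner_Integration.integrable_add integrable_mult_right integrable_const
          integrable_std_gaussian_norm integrable_std_gaussian_norm_sq)
    have "\<bar>h (y + s *\<^sub>R z)\<bar> \<le> \<bar>h y\<bar> + norm (H y) * \<bar>s\<bar> * norm z + L / 2 * s\<^sup>2 * (norm z)\<^sup>2" for z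
    proof -
      have "\<bar>h (y + s *\<^sub>R z) - h y - H y \<bullet> (s *\<^sub>R z)\<bar> \<le> L / 2 * (norm (s *\<^sub>R z))\<^sup>2"
        by (rule lipschitz_grad_descent[OF h_GDERIV H_lipschitz])
      moreover have "L / 2 * (norm (s *\<^sub>R z))\<^sup>2 = L / 2 * s\<^sup>2 * (norm z)\<^sup>2"
        by (simp add: power_mult_distrib)
      moreover have "\<bar>H y \<bullet> (s *\<^sub>R z)\<bar> \<le> norm (H y) * \<bar>s\<bar> * norm z"
        using Cauchy_Schwarz_ineq2[of "H y" "s *\<^sub>R z"] by (simp add: mult.assoc)
      ultimately show ?thesis by linarith
    qed
    then show "AE z in std_gaussian. norm (h (y + s *\<^sub>R z))
        \<le> norm (\<bar>h y\<bar> + norm (H y) * \<bar>s\<bar> * norm z + L / 2 * s\<^sup>2 * (norm z)\<^sup>2)"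
      by (intro AE_I2) (metis abs_ge_self order_trans real_norm_def)
  qed measurable
qed

definition smoothed_grad :: "real \<Rightarrow> 'a \<Rightarrow> 'a" where
  "smoothed_grad s y = (\<integral>z. H (y + s *\<^sub>R z) \<partial>std_gaussian)"

text \<open>The descent estimate has the same constant at every base point
  \<open>y + s *\<^sub>R z\<close>, so it survives averaging over \<open>z\<close>.\<close>

lemma GDERIV_smoothed: "GDERIV (\<lambda>y. \<integral>z. h (y + s *\<^sub>R z) \<partial>std_gaussian) y :> smoothed_grad s y"
proof (rule GDERIV_of_quadratic_remainder[where C = "L / 2"])
  interpret prob_space "std_gaussian :: 'a measure" by (rule prob_space_std_gaussian)
  fix k :: 'a
  have "(\<integral>z. h (y + k + s *\<^sub>R z) \<partial>std_gaussian) - (\<integral>z. h (y + s *\<^sub>R z) \<partial>std_gaussian) - smoothed_grad s y \<bullet> k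
      = (\<integral>z. h (y + k + s *\<^sub>R z) - h (y + s *\<^sub>R z) - H (y + s *\<^sub>R z) \<bullet> k \<partial>std_gaussian)"
    unfolding smoothed_grad_def
    using integrable_gaussian[of "y + k" s] integrable_gaussian[of y s] integrable_grad_gaussian[of y s]
    by simp
  also have "\<bar>\<dots>\<bar> \<le> (\<integral>z. L / 2 * (norm k)\<^sup>2 \<partial>(std_gaussian :: 'a measure))"
  proof (rule order_trans[OF integral_abs_bound integral_mono])
    show "integrable std_gaussian (\<lambda>z. \<bar>h (y + k + s *\<^sub>R z) - h (y + s *\<^sub>R z) - H (y + s *\<^sub>R z) \<bullet> k\<bar>)"
      using integrable_gaussian[of "y + k" s] integrable_gaussian[of y s] integrable_grad_gaussian[of y s]
      by simp
    show "\<bar>h (y + k + s *\<^sub>R z) - h (y + s *\<^sub>R z) - H (y + s *\<^sub>R z) \<bullet> k\<bar> \<le> L / 2 * (norm k)\<^sup>2" for z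
      using lipschitz_grad_descent[OF h_GDERIV H_lipschitz, of "y + s *\<^sub>R z" k] by (simp add: ac_simps)
  qed simp
  finally show "\<bar>(\<integral>z. h (y + k + s *\<^sub>R z) \<partial>std_gaussian) - (\<integral>z. h (y + s *\<^sub>R z) \<partial>std_gaussian)
      - smoothed_grad s y \<bullet> k\<bar> \<le> L / 2 * (norm k)\<^sup>2"
    using prob_space by simp
qed

text \<open>The scales may differ: equal ones give the Lipschitz bound, and \<open>s' = 0\<close>
  compares with the unsmoothed gradient.\<close>

lemma smoothed_grad_close:
  assumes "\<And>z. norm (H (y + s *\<^sub>R z) - H (y' + s' *\<^sub>R z)) \<le> C z" and "integrable std_gaussian C"
  shows "norm (smoothed_grad s y - smoothed_grad s' y') \<le> (\<integral>z. C z \<partial>std_gaussian)"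
proof -
  have "smoothed_grad s y - smoothed_grad s' y'
      = (\<integral>z. H (y + s *\<^sub>R z) - H (y' + s' *\<^sub>R z) \<partial>std_gaussian)"
    unfolding smoothed_grad_def using integrable_grad_gaussian by simp
  also have "norm \<dots> \<le> (\<integral>z. norm (H (y + s *\<^sub>R z) - H (y' + s' *\<^sub>R z)) \<partial>std_gaussian)"
    by (rule integral_norm_bound)
  also have "\<dots> \<le> (\<integral>z. C z \<partial>std_gaussian)"
    using assms integrable_grad_gaussian by (intro integral_mono) auto
  finally show ?thesis .
qed

lemma smoothed_grad_lipschitz: "L-lipschitz_on UNIV (smoothed_grad s)"
proof (rule lipschitz_onI)
  interpret prob_space "std_gaussian :: 'a measure" by (rule prob_space_std_gaussian)
  fix y y' :: 'a
  have "norm (smoothed_grad s y - smoothed_grad s y') \<le> (\<integral>z. L * norm (y - y') \<partial>(std_gaussian :: 'a measure))"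
  proof (rule smoothed_grad_close)
    show "norm (H (y + s *\<^sub>R z) - H (y' + s *\<^sub>R z)) \<le> L * norm (y - y')" for z
      using H_diff_le[of "y + s *\<^sub>R z" "y' + s *\<^sub>R z"] by simp
  qed simp
  then show "dist (smoothed_grad s y) (smoothed_grad s y') \<le> L * dist y y'"
    using prob_space by (simp add: dist_norm)
qed (rule L_nonneg)

text \<open>Expanding the square, the cross term has mean zero and the pure noise term is
  nonnegative, so the constants \<open>c\<close> and \<open>C\<close> persist.\<close>

lemma smoothed_coercive:
  assumes h: "\<And>y. h y \<ge> c * (norm y)\<^sup>2 - C" and c: "c \<ge> 0"
  shows "(\<integral>z. h (y + s *\<^sub>R z) \<partial>std_gaussian) \<ge> c * (norm y)\<^sup>2 - C"
proof -
  interpret prob_space "std_gaussian :: 'a measure" by (rule prob_space_std_gaussian)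
  have inner_integrable: "integrable std_gaussian (\<lambda>z. (2 * c * s) *\<^sub>R y \<bullet> z)"
    by (rule integrable_std_gaussian_inner)
  have "(\<integral>z. (c * (norm y)\<^sup>2 - C) + (2 * c * s) *\<^sub>R y \<bullet> z \<partial>std_gaussian) \<le> (\<integral>z. h (y + s *\<^sub>R z) \<partial>std_gaussian)"
  proof (rule integral_mono)
    show "integrable std_gaussian (\<lambda>z. (c * (norm y)\<^sup>2 - C) + (2 * c * s) *\<^sub>R y \<bullet> z)"
      using inner_integrable by (intro Bochner_Integration.integrable_add integrable_const)
    fix z
    have "(norm y)\<^sup>2 + 2 * s * (y \<bullet> z) \<le> (norm y)\<^sup>2 + 2 * s * (y \<bullet> z) + (norm (s *\<^sub>R z))\<^sup>2" by simp
    also have "\<dots> = (norm (y + s *\<^sub>R z))\<^sup>2"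
      unfolding power2_norm_eq_inner by (simp add: inner_add_left inner_add_right inner_commute)
    finally have "c * ((norm y)\<^sup>2 + 2 * s * (y \<bullet> z)) \<le> c * (norm (y + s *\<^sub>R z))\<^sup>2"
      using c by (rule mult_left_mono)
    then show "(c * (norm y)\<^sup>2 - C) + (2 * c * s) *\<^sub>R y \<bullet> z \<le> h (y + s *\<^sub>R z)"
      using h[of "y + s *\<^sub>R z"] by (simp add: algebra_simps)
  qed (rule integrable_gaussian)
  moreover have "(\<integral>z. (c * (norm y)\<^sup>2 - C) + (2 * c * s) *\<^sub>R y \<bullet> z \<partial>std_gaussian)
      = (\<integral>z. c * (norm y)\<^sup>2 - C \<partial>(std_gaussian :: 'a measure)) + (\<integral>z. (2 * c * s) *\<^sub>R y \<bullet> z \<partial>std_gaussian)"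
    by (rule Bochner_Integration.integral_add[OF integrable_const inner_integrable])
  ultimately show ?thesis
    unfolding integral_std_gaussian_inner using prob_space by simp
qed

text \<open>
  Only the deviation of \<open>H\<close> from \<open>H y\<close> matters, since \<open>H y \<bullet> z\<close> is centred; so the bound does
  not involve \<open>H y\<close>.
\<close>

lemma smoothed_scale_change:
  assumes k_int: "\<And>y. integrable std_gaussian (\<lambda>z. k (y + s' *\<^sub>R z))"
    and k: "\<And>p. \<bar>k p - h p\<bar> \<le> \<bar>s' - s\<bar> * (C * (1 + (norm p)\<^sup>2))" and C: "C \<ge> 0"
    and s: "0 \<le> s" "s \<le> S" "0 \<le> s'" "s' \<le> S"
  shows "\<bar>(\<integral>z. k (y + s' *\<^sub>R z) \<partial>std_gaussian) - (\<integral>z. h (y + s *\<^sub>R z) \<partial>std_gaussian)\<bar>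
    \<le> \<bar>s' - s\<bar> * ((2 * C * (1 + S\<^sup>2 * gaussian_variance TYPE('a)) + 2 * L * S * gaussian_variance TYPE('a)) * (1 + (norm y)\<^sup>2))"
proof -
  interpret prob_space "std_gaussian :: 'a measure" by (rule prob_space_std_gaussian)
  define m where "m = gaussian_variance TYPE('a)"
  have m: "m \<ge> 0" by (simp add: m_def gaussian_variance_nonneg)
  have S: "S \<ge> 0" using s by linarith
  define D where "D z = k (y + s' *\<^sub>R z) - h (y + s *\<^sub>R z) - ((s' - s) *\<^sub>R H y) \<bullet> z" for z
  have inner_integrable: "integrable std_gaussian (\<lambda>z. ((s' - s) *\<^sub>R H y) \<bullet> z)"
    by (rule integrable_std_gaussian_inner)
  have D_integrable: "integrable std_gaussian D"
    unfolding D_def using k_int integrable_gaussian inner_integrable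
    by (intro Bochner_Integration.integrable_diff)
  have "(\<integral>z. D z \<partial>std_gaussian) = (\<integral>z. k (y + s' *\<^sub>R z) \<partial>std_gaussian) - (\<integral>z. h (y + s *\<^sub>R z) \<partial>std_gaussian)
      - (\<integral>z. ((s' - s) *\<^sub>R H y) \<bullet> z \<partial>std_gaussian)"
    unfolding D_def
    by (simp only: Bochner_Integration.integral_diff Bochner_Integration.integrable_diff
        k_int integrable_gaussian inner_integrable)
  then have D_eq: "(\<integral>z. k (y + s' *\<^sub>R z) \<partial>std_gaussian) - (\<integral>z. h (y + s *\<^sub>R z) \<partial>std_gaussian) = (\<integral>z. D z \<partial>std_gaussian)"
    unfolding integral_std_gaussian_inner by simp
  \<comment> \<open>Three contributions, each with a factor \<open>\<bar>s' - s\<bar>\<close>: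
    replacing \<open>k\<close> by \<open>h\<close> at one point, the second-order remainder of
    \<open>h\<close> between the scales, and the change of \<open>H\<close> from \<open>y\<close> to
    \<open>y + s *\<^sub>R z\<close>. In the second, a further factor
    \<open>\<bar>s' - s\<bar>\<close> is bounded by \<open>S\<close>.\<close>
  have D_bound: "\<bar>D z\<bar> \<le> \<bar>s' - s\<bar> * (C * (1 + 2 * (norm y)\<^sup>2)) + \<bar>s' - s\<bar> * (2 * C * S\<^sup>2 + 2 * L * S) * (norm z)\<^sup>2" for z
  proof -
    have "(norm (y + s' *\<^sub>R z))\<^sup>2 \<le> 2 * (norm y)\<^sup>2 + 2 * (norm (s' *\<^sub>R z))\<^sup>2"
      by (rule norm_sq_add_le)
    also have "(norm (s' *\<^sub>R z))\<^sup>2 \<le> S\<^sup>2 * (norm z)\<^sup>2"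
      using s by (auto simp: power_mult_distrib intro!: mult_right_mono power_mono)
    finally have "\<bar>s' - s\<bar> * (C * (1 + (norm (y + s' *\<^sub>R z))\<^sup>2))
        \<le> \<bar>s' - s\<bar> * (C * (1 + (2 * (norm y)\<^sup>2 + 2 * (S\<^sup>2 * (norm z)\<^sup>2))))"
      using C by (intro mult_left_mono) auto
    then have 1: "\<bar>k (y + s' *\<^sub>R z) - h (y + s' *\<^sub>R z)\<bar>
        \<le> \<bar>s' - s\<bar> * (C * (1 + (2 * (norm y)\<^sup>2 + 2 * (S\<^sup>2 * (norm z)\<^sup>2))))"
      using k[of "y + s' *\<^sub>R z"] by linarith
    have "\<bar>h (y + s *\<^sub>R z + (s' - s) *\<^sub>R z) - h (y + s *\<^sub>R z) - H (y + s *\<^sub>R z) \<bullet> ((s' - s) *\<^sub>R z)\<bar>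
        \<le> L / 2 * (norm ((s' - s) *\<^sub>R z))\<^sup>2"
      by (rule lipschitz_grad_descent[OF h_GDERIV H_lipschitz])
    also have "\<dots> = \<bar>s' - s\<bar> * (L / 2 * \<bar>s' - s\<bar> * (norm z)\<^sup>2)"
      by (simp add: power_mult_distrib power2_eq_square)
    also have "\<dots> \<le> \<bar>s' - s\<bar> * (L * S * (norm z)\<^sup>2)"
      using s L_nonneg by (intro mult_left_mono mult_right_mono mult_mono) auto
    also have "y + s *\<^sub>R z + (s' - s) *\<^sub>R z = y + s' *\<^sub>R z" by (simp add: scaleR_diff_left)
    finally have 2: "\<bar>h (y + s' *\<^sub>R z) - h (y + s *\<^sub>R z) - H (y + s *\<^sub>R z) \<bullet> ((s' - s) *\<^sub>R z)\<bar>
        \<le> \<bar>s' - s\<bar> * (L * S * (norm z)\<^sup>2)" .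
    have "\<bar>(H (y + s *\<^sub>R z) - H y) \<bullet> ((s' - s) *\<^sub>R z)\<bar>
        \<le> norm (H (y + s *\<^sub>R z) - H y) * norm ((s' - s) *\<^sub>R z)"
      by (rule Cauchy_Schwarz_ineq2)
    also have "\<dots> \<le> (L * S * norm z) * (\<bar>s' - s\<bar> * norm z)"
      using s L_nonneg by (intro mult_mono order_trans[OF H_shift_le]) (auto intro!: mult_right_mono mult_left_mono)
    finally have 3: "\<bar>H (y + s *\<^sub>R z) \<bullet> ((s' - s) *\<^sub>R z) - ((s' - s) *\<^sub>R H y) \<bullet> z\<bar>
        \<le> \<bar>s' - s\<bar> * (L * S * (norm z)\<^sup>2)"
      by (simp add: inner_diff_left right_diff_distrib power2_eq_square ac_simps)
    have "\<bar>D z\<bar> \<le> \<bar>s' - s\<bar> * (C * (1 + (2 * (norm y)\<^sup>2 + 2 * (S\<^sup>2 * (norm z)\<^sup>2))))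
        + \<bar>s' - s\<bar> * (L * S * (norm z)\<^sup>2) + \<bar>s' - s\<bar> * (L * S * (norm z)\<^sup>2)"
      using 1 2 3 unfolding D_def by linarith
    then show ?thesis by (simp add: algebra_simps)
  qed
  have "\<bar>\<integral>z. D z \<partial>std_gaussian\<bar> \<le> (\<integral>z. \<bar>s' - s\<bar> * (C * (1 + 2 * (norm y)\<^sup>2))
      + \<bar>s' - s\<bar> * (2 * C * S\<^sup>2 + 2 * L * S) * (norm z)\<^sup>2 \<partial>(std_gaussian :: 'a measure))"
    using D_integrable integrable_std_gaussian_norm_sq
    by (intro order_trans[OF integral_abs_bound integral_mono] D_bound
        Bochner_Integration.integrable_add integrable_mult_right integrable_const) auto
  also have "\<dots> = \<bar>s' - s\<bar> * (C * (1 + 2 * (norm y)\<^sup>2)) + \<bar>s' - s\<bar> * (2 * C * S\<^sup>2 + 2 * L * S) * m"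
    using integrable_std_gaussian_norm_sq prob_space
    by (subst Bochner_Integration.integral_add) (auto simp: m_def gaussian_variance_def)
  also have "\<dots> \<le> \<bar>s' - s\<bar> * ((2 * C * (1 + S\<^sup>2 * m) + 2 * L * S * m) * (1 + (norm y)\<^sup>2))"
  proof -
    have "0 \<le> C + 2 * C * S\<^sup>2 * m * (norm y)\<^sup>2 + 2 * L * S * m * (norm y)\<^sup>2"
      using C m S L_nonneg by (intro add_nonneg_nonneg mult_nonneg_nonneg) auto
    then have "C * (1 + 2 * (norm y)\<^sup>2) + (2 * C * S\<^sup>2 + 2 * L * S) * m
        \<le> (2 * C * (1 + S\<^sup>2 * m) + 2 * L * S * m) * (1 + (norm y)\<^sup>2)"
      by (simp add: algebra_simps)
    from mult_left_mono[OF this abs_ge_zero[of "s' - s"]] show ?thesis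
      by (simp add: algebra_simps)
  qed
  finally show ?thesis unfolding D_eq m_def .
qed

end

subsection \<open>Noise driven by independent variables\<close>

context prob_space
begin

text \<open>Freezing: by Fubini the second variable is integrated while the first is held fixed.
  Independence is expressed by the law of the pair, so \<open>X\<close> and \<open>Y\<close> may
  take values in different types.\<close>

lemma integral_of_product_law:
  fixes \<Phi> :: "_ \<Rightarrow> real"
  assumes [measurable]: "X \<in> measurable M S" "Y \<in> measurable M T"
    and law: "distr M S X \<Otimes>\<^sub>M distr M T Y = distr M (S \<Otimes>\<^sub>M T) (\<lambda>w. (X w, Y w))"
    and \<Phi>: "\<Phi> \<in> borel_measurable (S \<Otimes>\<^sub>M T)"
    and int: "integrable M (\<lambda>w. \<Phi> (X w, Y w))"
  shows "(\<integral>w. \<Phi> (X w, Y w) \<partial>M) = (\<integral>w. \<integral>z. \<Phi> (X w, z) \<partial>(distr M T Y) \<partial>M)"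
proof -
  interpret S: prob_space "distr M S X" by (rule prob_space_distr) simp
  interpret T: prob_space "distr M T Y" by (rule prob_space_distr) simp
  interpret ST: pair_sigma_finite "distr M S X" "distr M T Y" ..
  note [measurable] = \<Phi>
  have "integrable (distr M (S \<Otimes>\<^sub>M T) (\<lambda>w. (X w, Y w))) \<Phi>"
    using int by (subst integrable_distr_eq) auto
  then have int': "integrable (distr M S X \<Otimes>\<^sub>M distr M T Y) \<Phi>" by (simp add: law)
  have "(\<integral>w. \<Phi> (X w, Y w) \<partial>M) = (\<integral>p. \<Phi> p \<partial>(distr M (S \<Otimes>\<^sub>M T) (\<lambda>w. (X w, Y w))))"
    by (subst integral_distr) auto
  also have "\<dots> = (\<integral>y. \<integral>z. \<Phi> (y, z) \<partial>(distr M T Y) \<partial>(distr M S X))"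
    unfolding law[symmetric] using ST.integral_fst'[OF int'] by simp
  also have "\<dots> = (\<integral>w. \<integral>z. \<Phi> (X w, z) \<partial>(distr M T Y) \<partial>M)"
    by (subst integral_distr) auto
  finally show ?thesis .
qed

end

text \<open>The natural filtration. Indices start at 1, so stage 0 is trivial, in accordance with a
  deterministic start.\<close>

definition history :: "'w measure \<Rightarrow> (nat \<Rightarrow> 'w \<Rightarrow> 'b::topological_space) \<Rightarrow> nat \<Rightarrow> 'w measure" where
  "history M Z k = vimage_algebra (space M) (\<lambda>w. \<lambda>i\<in>{1..k}. Z i w) (PiM {1..k} (\<lambda>_. borel))"

lemma space_history [simp]: "space (history M Z k) = space M"
  by (simp add: history_def)

locale independent_sequence = prob_space M for M :: "'w measure" +
  fixes Z :: "nat \<Rightarrow> 'w \<Rightarrow> 'b::topological_space"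
  assumes Z_indep: "indep_vars (\<lambda>_. borel) Z {1..}"
begin

lemma Z_measurable: "1 \<le> i \<Longrightarrow> Z i \<in> borel_measurable M"
  using Z_indep by (auto simp: indep_vars_def)

lemma tuple_measurable: "(\<lambda>w. \<lambda>i\<in>{1..k}. Z i w) \<in> measurable M (PiM {1..k} (\<lambda>_. borel))"
  by (intro measurable_restrict Z_measurable) auto

lemma tuple_space: "(\<lambda>w. \<lambda>i\<in>{1..k}. Z i w) \<in> space M \<rightarrow> space (PiM {1..k} (\<lambda>_. borel))"
  using measurable_space[OF tuple_measurable] by auto

lemma sets_history:
  "sets (history M Z k) = {(\<lambda>w. \<lambda>i\<in>{1..k}. Z i w) -` A \<inter> space M | A. A \<in> sets (PiM {1..k} (\<lambda>_. borel))}"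
  unfolding history_def by (rule sets_vimage_algebra2[OF tuple_space])

lemma sets_history_le: "sets (history M Z k) \<subseteq> sets M"
  unfolding sets_history using measurable_sets[OF tuple_measurable] by auto

lemma Z_history: "1 \<le> i \<Longrightarrow> i \<le> k \<Longrightarrow> Z i \<in> borel_measurable (history M Z k)"
proof -
  assume i: "1 \<le> i" "i \<le> k"
  have "(\<lambda>w. (\<lambda>i\<in>{1..k}. Z i w) i) \<in> borel_measurable (history M Z k)"
    unfolding history_def
    by (rule measurable_compose[OF measurable_vimage_algebra1[OF tuple_space] measurable_component_singleton])
      (use i in auto)
  then show ?thesis using i by simp
qed

lemma sets_history_Suc: "sets (history M Z k) \<subseteq> sets (history M Z (Suc k))"
proof -
  have "(\<lambda>w. \<lambda>i\<in>{1..k}. Z i w) \<in> measurable (history M Z (Suc k)) (PiM {1..k} (\<lambda>_. borel))"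
    by (intro measurable_restrict Z_history) auto
  then show ?thesis
    unfolding sets_history[of k] by (auto simp: measurable_def)
qed

lemma history_M: "V \<in> measurable (history M Z k) N \<Longrightarrow> V \<in> measurable M N"
  using sets_history_le[of k] by (auto simp: measurable_def)

lemma measurable_history_Suc:
  "V \<in> measurable (history M Z k) N \<Longrightarrow> V \<in> measurable (history M Z (Suc k)) N"
  using sets_history_Suc[of k] by (auto simp: measurable_def)

text \<open>Disjoint blocks of an independent family are independent. The single variable is treated
  as a one-coordinate tuple, so that both blocks are tuples, and \<open>B'\<close> is the cylinder
  over \<open>B\<close>.\<close>

lemma history_event_indep:
  assumes A: "A \<in> sets (history M Z k)" and B: "B \<in> sets borel"
  shows "prob (A \<inter> (Z (Suc k) -` B \<inter> space M)) = prob A * prob (Z (Suc k) -` B \<inter> space M)"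
proof -
  have ind: "indep_var (PiM {1..k} (\<lambda>_. borel)) (\<lambda>w. \<lambda>i\<in>{1..k}. Z i w)
      (PiM {Suc k} (\<lambda>_. borel)) (\<lambda>w. \<lambda>i\<in>{Suc k}. Z i w)"
    by (rule indep_var_restrict[OF Z_indep]) auto
  obtain A' where A': "A' \<in> sets (PiM {1..k} (\<lambda>_. borel))"
      "A = (\<lambda>w. \<lambda>i\<in>{1..k}. Z i w) -` A' \<inter> space M"
    using A unfolding sets_history by auto
  define B' where "B' = (\<lambda>v. v (Suc k)) -` B \<inter> space (PiM {Suc k} (\<lambda>_. borel :: 'b measure))"
  have B': "B' \<in> sets (PiM {Suc k} (\<lambda>_. borel))"
    unfolding B'_def using B by measurable
  have "(\<lambda>w. \<lambda>i\<in>{Suc k}. Z i w) -` B' \<inter> space M = Z (Suc k) -` B \<inter> space M"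
    by (auto simp: B'_def space_PiM)
  moreover have "(\<lambda>w. (\<lambda>i\<in>{1..k}. Z i w, \<lambda>i\<in>{Suc k}. Z i w)) -` (A' \<times> B') \<inter> space M
      = A \<inter> ((\<lambda>w. \<lambda>i\<in>{Suc k}. Z i w) -` B' \<inter> space M)"
    unfolding A'(2) by auto
  ultimately show ?thesis
    using indep_varD[OF ind A'(1) B'] A'(2) by simp
qed

text \<open>Rectangles determine the law, and their preimages intersect an event of the past with an
  event of the next variable. The target \<open>S\<close> is arbitrary so that \<open>V\<close> can
  be the identity into the history itself.\<close>

lemma product_law:
  assumes V: "V \<in> measurable (history M Z k) S" and \<phi>: "\<phi> \<in> measurable borel T"
  shows "distr M S V \<Otimes>\<^sub>M distr M T (\<lambda>w. \<phi> (Z (Suc k) w))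
    = distr M (S \<Otimes>\<^sub>M T) (\<lambda>w. (V w, \<phi> (Z (Suc k) w)))"
proof (rule pair_measure_eqI)
  have V_M [measurable]: "V \<in> measurable M S" by (rule history_M[OF V])
  have Z_M: "Z (Suc k) \<in> borel_measurable M" by (rule Z_measurable) simp
  have W [measurable]: "(\<lambda>w. \<phi> (Z (Suc k) w)) \<in> measurable M T"
    by (rule measurable_compose[OF Z_M \<phi>])
  interpret S: prob_space "distr M S V" by (rule prob_space_distr) simp
  interpret T: prob_space "distr M T (\<lambda>w. \<phi> (Z (Suc k) w))" by (rule prob_space_distr) simp
  show "sigma_finite_measure (distr M S V)" "sigma_finite_measure (distr M T (\<lambda>w. \<phi> (Z (Suc k) w)))"
    by unfold_locales
  show "sets (distr M S V \<Otimes>\<^sub>M distr M T (\<lambda>w. \<phi> (Z (Suc k) w)))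
      = sets (distr M (S \<Otimes>\<^sub>M T) (\<lambda>w. (V w, \<phi> (Z (Suc k) w))))"
    by (auto intro: sets_pair_measure_cong)
  fix A B assume "A \<in> sets (distr M S V)" "B \<in> sets (distr M T (\<lambda>w. \<phi> (Z (Suc k) w)))"
  then have [measurable]: "A \<in> sets S" "B \<in> sets T" by auto
  have A_history: "V -` A \<inter> space M \<in> sets (history M Z k)"
    using measurable_sets[OF V, of A] by simp
  have B_borel: "\<phi> -` B \<in> sets borel" using measurable_sets[OF \<phi>, of B] by simp
  have "(\<lambda>w. (V w, \<phi> (Z (Suc k) w))) -` (A \<times> B) \<inter> space M
      = (V -` A \<inter> space M) \<inter> (Z (Suc k) -` (\<phi> -` B) \<inter> space M)" by auto
  moreover have "(\<lambda>w. \<phi> (Z (Suc k) w)) -` B \<inter> space M = Z (Suc k) -` (\<phi> -` B) \<inter> space M" by auto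
  ultimately show "emeasure (distr M S V) A * emeasure (distr M T (\<lambda>w. \<phi> (Z (Suc k) w))) B
      = emeasure (distr M (S \<Otimes>\<^sub>M T) (\<lambda>w. (V w, \<phi> (Z (Suc k) w)))) (A \<times> B)"
    using history_event_indep[OF A_history B_borel]
    by (simp add: emeasure_distr emeasure_eq_measure ennreal_mult[symmetric])
qed

section \<open>Noise as a function of the current state and the next variable\<close>

context
  fixes \<nu> :: "'a::euclidean_space \<Rightarrow> 'b \<Rightarrow> 'a" and \<psi> :: "'b \<Rightarrow> real" and \<mu> :: "'b measure"
    and Y :: "'w \<Rightarrow> 'a" and k :: nat
  assumes \<nu>_measurable: "(\<lambda>(y, z). \<nu> y z) \<in> borel_measurable (borel \<Otimes>\<^sub>M borel)"
    and \<psi>_measurable: "\<psi> \<in> borel_measurable borel"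
    and \<nu>_bound: "\<And>y z. norm (\<nu> y z) \<le> \<psi> z" and \<nu>_integral: "\<And>y. (\<integral>z. \<nu> y z \<partial>\<mu>) = 0"
    and \<psi>_sq: "integrable \<mu> (\<lambda>z. (\<psi> z)\<^sup>2)"
    and Z_distr: "distr M borel (Z (Suc k)) = \<mu>"
    and Y_adapted: "Y \<in> borel_measurable (history M Z k)"
begin

lemmas [measurable] = \<nu>_measurable \<psi>_measurable

lemma Z_Suc_M [measurable]: "Z (Suc k) \<in> borel_measurable M"
  by (rule Z_measurable) simp

lemma id_history_M: "(\<lambda>w. w) \<in> measurable M (history M Z k)"
  using sets_history_le[of k] by (auto simp: measurable_def)

lemma noise_M [measurable]: "(\<lambda>w. \<nu> (Y w) (Z (Suc k) w)) \<in> borel_measurable M"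
  using measurable_compose[OF measurable_Pair[OF history_M[OF Y_adapted] Z_Suc_M] \<nu>_measurable] by simp

lemma sets_\<mu>: "sets \<mu> = sets borel"
  using Z_distr by (metis sets_distr)

lemma \<psi>_Z_sq_integrable: "integrable M (\<lambda>w. (\<psi> (Z (Suc k) w))\<^sup>2)"
  using \<psi>_sq unfolding Z_distr[symmetric] by (subst (asm) integrable_distr_eq) auto

lemma \<psi>_Z_sq_integral: "(\<integral>w. (\<psi> (Z (Suc k) w))\<^sup>2 \<partial>M) = (\<integral>z. (\<psi> z)\<^sup>2 \<partial>\<mu>)"
  unfolding Z_distr[symmetric] by (subst integral_distr) auto

lemma indep_past_Z:
  fixes V :: "'w \<Rightarrow> real" and \<phi> :: "'b \<Rightarrow> real"
  assumes "V \<in> borel_measurable (history M Z k)" "\<phi> \<in> borel_measurable borel"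
  shows "indep_var borel V borel (\<lambda>w. \<phi> (Z (Suc k) w))"
  unfolding indep_var_distribution_eq
  using product_law[OF assms] measurable_compose[OF Z_Suc_M assms(2)] history_M[OF assms(1)] by simp

lemma noise_centred:
  assumes U: "U \<in> borel_measurable (history M Z k)" and U_int: "integrable M (\<lambda>w. norm (U w))"
  shows "(\<integral>w. U w \<bullet> \<nu> (Y w) (Z (Suc k) w) \<partial>M) = 0"
proof -
  note [measurable] = U Y_adapted history_M[OF U]
  \<comment> \<open>\<open>U\<close> is merely integrable; the product is integrable because its two
    factors are independent.\<close>
  have "integrable M (\<lambda>w. norm (U w) * \<psi> (Z (Suc k) w))"
    by (rule indep_var_integrable[OF indep_past_Z U_int square_integrable_imp_integrable[OF _ \<psi>_Z_sq_integrable]])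
      measurable
  then have "integrable M (\<lambda>w. U w \<bullet> \<nu> (Y w) (Z (Suc k) w))"
  proof (rule Bochner_Integration.integrable_bound)
    show "AE w in M. norm (U w \<bullet> \<nu> (Y w) (Z (Suc k) w)) \<le> norm (norm (U w) * \<psi> (Z (Suc k) w))"
    proof (intro AE_I2)
      fix w
      have "\<bar>U w \<bullet> \<nu> (Y w) (Z (Suc k) w)\<bar> \<le> norm (U w) * \<psi> (Z (Suc k) w)"
        by (rule order_trans[OF Cauchy_Schwarz_ineq2 mult_left_mono[OF \<nu>_bound]]) simp
      then show "norm (U w \<bullet> \<nu> (Y w) (Z (Suc k) w)) \<le> norm (norm (U w) * \<psi> (Z (Suc k) w))"
        by (auto intro: order_trans)
    qed
  qed measurable
  \<comment> \<open>The first component of the pair is the identity into the history, so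
    \<open>U\<close> and \<open>Y\<close> are frozen together.\<close>
  then have "(\<integral>w. U w \<bullet> \<nu> (Y w) (Z (Suc k) w) \<partial>M) = (\<integral>w. \<integral>z. U w \<bullet> \<nu> (Y w) z \<partial>\<mu> \<partial>M)"
    using integral_of_product_law[OF id_history_M Z_Suc_M product_law[where \<phi> = "\<lambda>z. z"],
        of "\<lambda>(w, z). U w \<bullet> \<nu> (Y w) z"]
    by (simp add: Z_distr)
  also have "\<dots> = (\<integral>w. 0 \<partial>M)"
  proof (rule Bochner_Integration.integral_cong[OF refl])
    fix w
    have \<mu>: "prob_space \<mu>" unfolding Z_distr[symmetric] by (rule prob_space_distr) simp
    have [measurable]: "\<nu> (Y w) \<in> borel_measurable borel" "\<psi> \<in> borel_measurable \<mu>" "\<nu> (Y w) \<in> borel_measurable \<mu>"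
      using measurable_compose[OF measurable_Pair1' \<nu>_measurable, of "Y w"] sets_\<mu>
      by (auto simp: measurable_cong_sets[OF sets_\<mu> refl])
    have "integrable \<mu> \<psi>"
      by (rule finite_measure.square_integrable_imp_integrable[OF prob_space.finite_measure[OF \<mu>] _ \<psi>_sq]) simp
    then have "integrable \<mu> (\<nu> (Y w))"
    proof (rule Bochner_Integration.integrable_bound)
      show "AE z in \<mu>. norm (\<nu> (Y w) z) \<le> norm (\<psi> z)"
        by (intro AE_I2 order_trans[OF \<nu>_bound]) simp
    qed measurable
    then show "(\<integral>z. U w \<bullet> \<nu> (Y w) z \<partial>\<mu>) = 0" by (simp add: \<nu>_integral)
  qed
  finally show ?thesis by simp
qed

text \<open>\<open>\<psi>\<close> bounds the noise uniformly in the state, so after domination the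
  expectation splits into two independent factors.\<close>

lemma noise_variance:
  fixes U :: "'w \<Rightarrow> real"
  assumes U: "U \<in> borel_measurable (history M Z k)" and U2: "integrable M (\<lambda>w. (U w)\<^sup>2)"
  shows "integrable M (\<lambda>w. (U w)\<^sup>2 * (norm (\<nu> (Y w) (Z (Suc k) w)))\<^sup>2)"
    and "(\<integral>w. (U w)\<^sup>2 * (norm (\<nu> (Y w) (Z (Suc k) w)))\<^sup>2 \<partial>M) \<le> (\<integral>z. (\<psi> z)\<^sup>2 \<partial>\<mu>) * (\<integral>w. (U w)\<^sup>2 \<partial>M)"
proof -
  note [measurable] = U history_M[OF U]
  have ind: "indep_var borel (\<lambda>w. (U w)\<^sup>2) borel (\<lambda>w. (\<psi> (Z (Suc k) w))\<^sup>2)"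
    by (rule indep_past_Z) measurable
  note int = indep_var_integrable[OF ind U2 \<psi>_Z_sq_integrable]
  have le: "(U w)\<^sup>2 * (norm (\<nu> (Y w) (Z (Suc k) w)))\<^sup>2 \<le> (U w)\<^sup>2 * (\<psi> (Z (Suc k) w))\<^sup>2" for w
    by (intro mult_left_mono power_mono \<nu>_bound) auto
  show 1: "integrable M (\<lambda>w. (U w)\<^sup>2 * (norm (\<nu> (Y w) (Z (Suc k) w)))\<^sup>2)"
    using le by (intro Bochner_Integration.integrable_bound[OF int]) auto
  have "(\<integral>w. (U w)\<^sup>2 * (norm (\<nu> (Y w) (Z (Suc k) w)))\<^sup>2 \<partial>M) \<le> (\<integral>w. (U w)\<^sup>2 * (\<psi> (Z (Suc k) w))\<^sup>2 \<partial>M)"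
    by (intro integral_mono 1 int le)
  also have "\<dots> = (\<integral>w. (U w)\<^sup>2 \<partial>M) * (\<integral>w. (\<psi> (Z (Suc k) w))\<^sup>2 \<partial>M)"
    by (rule indep_var_lebesgue_integral[OF ind U2 \<psi>_Z_sq_integrable])
  finally show "(\<integral>w. (U w)\<^sup>2 * (norm (\<nu> (Y w) (Z (Suc k) w)))\<^sup>2 \<partial>M) \<le> (\<integral>z. (\<psi> z)\<^sup>2 \<partial>\<mu>) * (\<integral>w. (U w)\<^sup>2 \<partial>M)"
    by (simp add: \<psi>_Z_sq_integral mult.commute)
qed

end

end

subsection \<open>Convergence of the iterates\<close>

theorem theorem3p6:
  fixes f :: "'a::euclidean_space \<Rightarrow> real"
    and g :: "real \<Rightarrow> 'a \<Rightarrow> real"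
    and \<sigma> \<gamma> :: "nat \<Rightarrow> real"
    and \<epsilon> L\<^sub>f L\<^sub>g c\<^sub>0 C\<^sub>0 M\<^sub>g lam \<gamma>bar :: real
    and x\<^sub>0 :: 'a
    and M :: "'w measure"
    and Z x :: "nat \<Rightarrow> 'w \<Rightarrow> 'a"
  assumes f_C1: "C1_on UNIV f"
    and f_bdd: "bdd_below (range f)"
    and f_subanalytic: "subanalytic_on UNIV f"
    and f_lipschitz: "L\<^sub>f-lipschitz_on UNIV (grad f)"
    and \<sigma>_decreasing: "\<And>k. \<sigma> (Suc k) \<le> \<sigma> k"
    and \<sigma>_lim: "\<sigma> \<longlonglongrightarrow> \<epsilon>"
    and \<epsilon>_pos: "\<epsilon> > 0"
    and g_C2: "C2_on (UNIV \<times> {0<..}) (\<lambda>(y, s). g s y)"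
    and g_subanalytic: "subanalytic_on (UNIV \<times> {0<..}) (\<lambda>(y, s). g s y)"
    and g_lipschitz: "\<And>s. s \<in> {\<epsilon>..\<sigma> 0} \<Longrightarrow> L\<^sub>g-lipschitz_on UNIV (grad (g s))"
    and constants_pos: "c\<^sub>0 > 0" "C\<^sub>0 > 0" "M\<^sub>g > 0"
    and g_coercive: "\<And>s y. s \<in> {\<epsilon>..\<sigma> 0} \<Longrightarrow> g s y \<ge> c\<^sub>0 * (norm y)\<^sup>2 - C\<^sub>0"
    and g_dsigma: "\<And>s y. s \<in> {\<epsilon>..\<sigma> 0} \<Longrightarrow> \<bar>deriv (\<lambda>t. g t y) s\<bar> \<le> M\<^sub>g * (1 + (norm y)\<^sup>2)"
    and lam_pos: "lam > 0"
    and \<gamma>_bounds: "\<And>k. 0 < \<gamma> k" "\<And>k. \<gamma> k \<le> \<gamma>bar"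
    and \<gamma>bar: "(L\<^sub>f + lam * L\<^sub>g) * \<gamma>bar < 2"
    and \<gamma>_diverges: "filterlim (\<lambda>n. \<Sum>k<n. \<gamma> k) at_top sequentially"
    and \<gamma>_square_summable: "summable (\<lambda>k. (\<gamma> k)\<^sup>2)"
    and prob: "prob_space M"
    and Z_indep: "prob_space.indep_vars M (\<lambda>_. borel) Z {1..}"
    and Z_distr: "\<And>k. k \<ge> 1 \<Longrightarrow> distr M borel (Z k) = std_gaussian"
    and x_init: "\<And>w. w \<in> space M \<Longrightarrow> x 0 w = x\<^sub>0"
    and x_step: "\<And>k w. w \<in> space M \<Longrightarrow>
      x (Suc k) w = x k w - \<gamma> k *\<^sub>R (grad f (x k w)
        + lam *\<^sub>R (x k w - denoiser g (\<sigma> k) (x k w + \<sigma> k *\<^sub>R Z (Suc k) w)))"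
  shows "(AE w in M.
      (\<lambda>k. norm (grad (objective f lam g \<epsilon>) (x k w))) \<longlonglongrightarrow> 0 \<and>
      (\<lambda>k. norm (x (Suc k) w - x k w)) \<longlonglongrightarrow> 0 \<and>
      (\<forall>r l. strict_mono r \<longrightarrow> (\<lambda>n. x (r n) w) \<longlonglongrightarrow> l \<longrightarrow> l \<in> crit (objective f lam g \<epsilon>)) \<and>
      crit (objective f lam g \<epsilon>) \<noteq> {} \<and>
      (\<lambda>k. infdist (x k w) (crit (objective f lam g \<epsilon>))) \<longlonglongrightarrow> 0) \<and>
      (\<forall>k. integrable M (\<lambda>w. (norm (grad (objective f lam g (\<sigma> k)) (x k w)))\<^sup>2)) \<and>
      (\<lambda>K. MIN k\<in>{..K}. \<integral>w. (norm (grad (objective f lam g (\<sigma> k)) (x k w)))\<^sup>2 \<partial>M)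
        \<in> O(\<lambda>K. inverse (\<Sum>j\<le>K. \<gamma> j))"
proof -
  interpret independent_sequence M Z
    using prob Z_indep by (simp add: independent_sequence_def independent_sequence_axioms_def)

  \<comment> \<open>Smoothed objectives and their gradients\<close>
  define L where "L = L\<^sub>f + lam * L\<^sub>g"
  define I where "I = {\<epsilon>..\<sigma> 0}"
  have "decseq \<sigma>" using \<sigma>_decreasing by (rule decseq_SucI)
  then have \<sigma>_I: "\<sigma> k \<in> I" for k
    using decseq_ge[OF _ \<sigma>_lim] decseqD[of \<sigma> 0 k] by (auto simp: I_def)
  have \<epsilon>_I: "\<epsilon> \<in> I" using \<sigma>_I[of 0] by (auto simp: I_def)
  have I_pos: "s > 0" if "s \<in> I" for s using that \<epsilon>_pos by (auto simp: I_def)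
  have f_GDERIV: "GDERIV f y :> grad f y" for y using f_C1 by (rule C1_on_UNIV_GDERIV)
  have smooth: "smooth_function (g s) (grad (g s)) L\<^sub>g" if "s \<in> I" for s
    using C2_on_partial_derivatives(1)[OF g_C2 I_pos[OF that]] g_lipschitz that
    unfolding smooth_function_def I_def by auto
  have L\<^sub>g: "L\<^sub>g \<ge> 0" using smooth_function.L_nonneg[OF smooth[OF \<epsilon>_I]] .
  have L\<^sub>f: "L\<^sub>f \<ge> 0" using f_lipschitz by (rule lipschitz_on_nonneg)
  have L: "L \<ge> 0" using L\<^sub>f L\<^sub>g lam_pos by (simp add: L_def)

  define SG where "SG s = smooth_function.smoothed_grad (grad (g s)) s" for s
  define OG where "OG s y = grad f y + lam *\<^sub>R SG s y" for s y
  have smoothed_GDERIV: "GDERIV (smoothed g s) y :> SG s y" if "s \<in> I" for s y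
    unfolding SG_def smoothed_def[abs_def] by (rule smooth_function.GDERIV_smoothed[OF smooth[OF that]])
  have SG_lipschitz: "L\<^sub>g-lipschitz_on UNIV (SG s)" if "s \<in> I" for s
    unfolding SG_def by (rule smooth_function.smoothed_grad_lipschitz[OF smooth[OF that]])
  have obj_GDERIV: "GDERIV (objective f lam g s) y :> OG s y" if "s \<in> I" for s y
    unfolding objective_def[abs_def] OG_def gderiv_def
    using f_GDERIV[of y] smoothed_GDERIV[OF that, of y] unfolding gderiv_def
    by (auto intro!: derivative_eq_intros simp: inner_add_right)
  have OG_lipschitz: "L-lipschitz_on UNIV (OG s)" if "s \<in> I" for s
    unfolding OG_def L_def using f_lipschitz SG_lipschitz[OF that] lam_pos
    by (intro lipschitz_on_add lipschitz_on_cmult_nonneg) auto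
  have grad_obj: "grad (objective f lam g s) = OG s" if "s \<in> I" for s
    using GDERIV_imp_grad[OF obj_GDERIV[OF that]] by auto

  \<comment> \<open>Dependence of the objective on the smoothing level\<close>
  define K where "K = 2 * M\<^sub>g * (1 + (\<sigma> 0)\<^sup>2 * gaussian_variance TYPE('a)) + 2 * L\<^sub>g * \<sigma> 0 * gaussian_variance TYPE('a)"
  have K: "K \<ge> 0"
    using constants_pos L\<^sub>g I_pos[OF \<sigma>_I[of 0]] gaussian_variance_nonneg[of "TYPE('a)"] by (simp add: K_def)
  have g_scale: "\<bar>g s' p - g s p\<bar> \<le> \<bar>s' - s\<bar> * (M\<^sub>g * (1 + (norm p)\<^sup>2))" if "s \<in> I" "s' \<in> I" for s s' p
  proof -
    have "norm (g s' p - g s p) \<le> (M\<^sub>g * (1 + (norm p)\<^sup>2)) * norm (s' - s)"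
    proof (rule field_differentiable_bound)
      show "convex I" by (simp add: I_def)
      show "((\<lambda>t. g t p) has_field_derivative deriv (\<lambda>t. g t p) s) (at s within I)" if "s \<in> I" for s
        using C2_on_partial_derivatives(2)[OF g_C2 I_pos[OF that], of p] by (rule DERIV_subset) simp
      show "norm (deriv (\<lambda>t. g t p) s) \<le> M\<^sub>g * (1 + (norm p)\<^sup>2)" if "s \<in> I" for s
        using g_dsigma that by (simp add: I_def)
    qed (use that in auto)
    then show ?thesis by (simp add: mult.commute)
  qed
  \<comment> \<open>\<open>K\<close> is the constant of \<open>smoothed_scale_change\<close> for
    \<open>C = M\<^sub>g\<close> and \<open>S = \<sigma> 0\<close>.\<close>
  have obj_scale: "\<bar>objective f lam g s' y - objective f lam g s y\<bar> \<le> lam * K * \<bar>s' - s\<bar> * (1 + (norm y)\<^sup>2)"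
    if "s \<in> I" "s' \<in> I" for s s' y
  proof -
    have "\<bar>smoothed g s' y - smoothed g s y\<bar> \<le> \<bar>s' - s\<bar> * (K * (1 + (norm y)\<^sup>2))"
      unfolding smoothed_def K_def
    proof (rule smooth_function.smoothed_scale_change[OF smooth[OF that(1)]])
      show "integrable std_gaussian (\<lambda>z. g s' (y + s' *\<^sub>R z))" for y
        by (rule smooth_function.integrable_gaussian[OF smooth[OF that(2)]])
    qed (use g_scale that constants_pos I_pos in \<open>auto simp: I_def less_imp_le\<close>)
    then have "lam * \<bar>smoothed g s' y - smoothed g s y\<bar> \<le> lam * (\<bar>s' - s\<bar> * (K * (1 + (norm y)\<^sup>2)))"
      using lam_pos by (intro mult_left_mono) auto
    moreover have "objective f lam g s' y - objective f lam g s y = lam * (smoothed g s' y - smoothed g s y)"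
      by (simp add: objective_def right_diff_distrib)
    ultimately show ?thesis using lam_pos by (simp add: abs_mult ac_simps)
  qed

  \<comment> \<open>Shifted objectives with multiplicative drift\<close>
  obtain m where m: "\<And>y. m \<le> f y" using f_bdd by (auto simp: bdd_below_def)
  define \<kappa> where "\<kappa> = lam * c\<^sub>0"
  have \<kappa>: "\<kappa> > 0" using lam_pos constants_pos by (simp add: \<kappa>_def)
  \<comment> \<open>The lower bounds on \<open>f\<close> and on the smoothed regulariser give
    \<open>m + \<kappa> * (norm y)\<^sup>2 - lam * C\<^sub>0\<close>; the shift raises this to
    \<open>\<kappa> * (1 + (norm y)\<^sup>2)\<close>.\<close>
  define F where "F k y = objective f lam g (\<sigma> k) y + (lam * C\<^sub>0 + \<kappa> - m)" for k y
  have F_coercive: "\<kappa> * (1 + (norm y)\<^sup>2) \<le> F k y" for k y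
  proof -
    have "c\<^sub>0 * (norm y)\<^sup>2 - C\<^sub>0 \<le> smoothed g (\<sigma> k) y"
      unfolding smoothed_def using g_coercive[OF \<sigma>_I[unfolded I_def]] constants_pos
      by (intro smooth_function.smoothed_coercive[OF smooth[OF \<sigma>_I]]) auto
    then have "lam * (c\<^sub>0 * (norm y)\<^sup>2 - C\<^sub>0) \<le> lam * smoothed g (\<sigma> k) y"
      using lam_pos by (intro mult_left_mono) auto
    then show ?thesis using m[of y] by (simp add: F_def objective_def \<kappa>_def algebra_simps)
  qed
  \<comment> \<open>Chosen so that \<open>a k * (\<kappa> * (1 + (norm y)\<^sup>2))\<close> is the
    bound on the change of the objective; the sum telescopes.\<close>
  define a where "a k = lam * K / \<kappa> * (\<sigma> k - \<sigma> (Suc k))" for k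
  have a_nonneg: "a k \<ge> 0" for k
    using lam_pos K \<kappa> \<sigma>_decreasing[of k] by (simp add: a_def)
  have a_summable: "summable a"
    unfolding a_def by (rule summable_mult[OF telescope_summable'[OF \<sigma>_lim]])
  have F_drift: "F (Suc k) y \<le> (1 + a k) * F k y" for k y
  proof -
    have "F (Suc k) y - F k y \<le> lam * K * \<bar>\<sigma> (Suc k) - \<sigma> k\<bar> * (1 + (norm y)\<^sup>2)"
      using obj_scale[OF \<sigma>_I[of k] \<sigma>_I[of "Suc k"], of y] by (simp add: F_def)
    also have "\<dots> = a k * (\<kappa> * (1 + (norm y)\<^sup>2))"
      using \<kappa> \<sigma>_decreasing[of k] by (simp add: a_def)
    also have "\<dots> \<le> a k * F k y" using a_nonneg F_coercive by (intro mult_left_mono) auto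
    finally show ?thesis by (simp add: algebra_simps)
  qed
  have F_GDERIV: "GDERIV (F k) y :> OG (\<sigma> k) y" for k y
    using GDERIV_add[OF obj_GDERIV[OF \<sigma>_I] GDERIV_const] unfolding F_def[abs_def] by simp

  \<comment> \<open>The centred noise and its domination\<close>
  define \<nu> where "\<nu> k y z = lam *\<^sub>R (grad (g (\<sigma> k)) (y + \<sigma> k *\<^sub>R z) - \<sigma> k *\<^sub>R z - SG (\<sigma> k) y)" for k y z
  define n where "n k w = \<nu> k (x k w) (Z (Suc k) w)" for k w
  \<comment> \<open>The denoiser residual at the perturbed point is the gradient of \<open>g\<close>
    there minus \<open>\<sigma> k *\<^sub>R Z (Suc k) w\<close>; its mean for a fixed state is
    \<open>SG (\<sigma> k)\<close>, and the deviation times \<open>lam\<close> is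
    \<open>n k\<close>.\<close>
  have step: "x (Suc k) w = x k w - \<gamma> k *\<^sub>R (OG (\<sigma> k) (x k w) + n k w)" if "w \<in> space M" for k w
    unfolding x_step[OF that] by (simp add: denoiser_def OG_def n_def \<nu>_def algebra_simps)
  have grad_f_M: "grad f \<in> borel_measurable borel"
    using f_lipschitz by (rule lipschitz_borel_measurable)
  have grad_g_M: "grad (g (\<sigma> k)) \<in> borel_measurable borel" for k
    using smooth_function.H_lipschitz[OF smooth[OF \<sigma>_I]] by (rule lipschitz_borel_measurable)
  have SG_M: "SG (\<sigma> k) \<in> borel_measurable borel" for k
    using SG_lipschitz[OF \<sigma>_I] by (rule lipschitz_borel_measurable)
  have \<nu>_M: "(\<lambda>(y, z). \<nu> k y z) \<in> borel_measurable (borel \<Otimes>\<^sub>M borel)" for k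
    unfolding \<nu>_def split_beta'
    by (intro borel_measurable_scaleR borel_measurable_diff borel_measurable_add borel_measurable_const
        measurable_compose[OF _ grad_g_M] measurable_compose[OF _ SG_M] measurable_fst measurable_snd)
  have x_adapted: "x k \<in> borel_measurable (history M Z k)" for k
  proof (induction k)
    case 0
    have "(\<lambda>_. x\<^sub>0) \<in> borel_measurable (history M Z 0)" by simp
    then show ?case by (subst measurable_cong[where g = "\<lambda>_. x\<^sub>0"]) (auto simp: x_init)
  next
    case (Suc k)
    have "(\<lambda>w. x k w - \<gamma> k *\<^sub>R (grad f (x k w) + lam *\<^sub>R (grad (g (\<sigma> k)) (x k w + \<sigma> k *\<^sub>R Z (Suc k) w)
        - \<sigma> k *\<^sub>R Z (Suc k) w))) \<in> borel_measurable (history M Z (Suc k))"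
      by (intro borel_measurable_scaleR borel_measurable_diff borel_measurable_add borel_measurable_const
          measurable_compose[OF _ grad_f_M] measurable_compose[OF _ grad_g_M]
          measurable_history_Suc[OF Suc] Z_history) auto
    then show ?case
      by (rule measurable_cong[THEN iffD1, rotated]) (simp add: x_step denoiser_def)
  qed

  define \<psi>\<^sub>1 where "\<psi>\<^sub>1 = (\<integral>z. norm z \<partial>(std_gaussian :: 'a measure))"
  \<comment> \<open>The terms bound the shift of the gradient by the perturbation, the gap between
    smoothed and unsmoothed gradient, and the explicit Gaussian term, with \<open>\<sigma> k\<close>
    replaced by its maximum \<open>\<sigma> 0\<close>.\<close>
  define \<psi> where "\<psi> z = lam * (L\<^sub>g * \<sigma> 0 * (norm z + \<psi>\<^sub>1) + \<sigma> 0 * norm z)" for z :: 'a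
  define v where "v = (\<integral>z. (\<psi> z)\<^sup>2 \<partial>std_gaussian)"
  have \<psi>_M: "\<psi> \<in> borel_measurable borel" unfolding \<psi>_def by measurable
  interpret N: prob_space "std_gaussian :: 'a measure" by (rule prob_space_std_gaussian)
  have \<psi>_sq: "integrable std_gaussian (\<lambda>z. (\<psi> z)\<^sup>2)"
  proof -
    have "(\<lambda>z. (\<psi> z)\<^sup>2) = (\<lambda>z. (lam * (L\<^sub>g * \<sigma> 0 + \<sigma> 0))\<^sup>2 * (norm z)\<^sup>2
        + 2 * (lam * (L\<^sub>g * \<sigma> 0 + \<sigma> 0)) * (lam * L\<^sub>g * \<sigma> 0 * \<psi>\<^sub>1) * norm z + (lam * L\<^sub>g * \<sigma> 0 * \<psi>\<^sub>1)\<^sup>2)"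
      by (simp add: fun_eq_iff \<psi>_def power2_eq_square algebra_simps)
    then show ?thesis
      by (simp only:) (intro Bochner_Integration.integrable_add integrable_mult_right N.integrable_const
          integrable_std_gaussian_norm integrable_std_gaussian_norm_sq)
  qed
  have \<nu>_bound: "norm (\<nu> k y z) \<le> \<psi> z" for k y z
  proof -
    interpret S: smooth_function "g (\<sigma> k)" "grad (g (\<sigma> k))" L\<^sub>g by (rule smooth[OF \<sigma>_I])
    have \<sigma>k: "0 \<le> \<sigma> k" "\<sigma> k \<le> \<sigma> 0" using \<sigma>_I[of k] I_pos[OF \<sigma>_I[of k]] by (auto simp: I_def)
    have shift: "norm (grad (g (\<sigma> k)) (y + \<sigma> k *\<^sub>R z) - grad (g (\<sigma> k)) y) \<le> L\<^sub>g * \<sigma> 0 * norm z" for z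
      using \<sigma>k L\<^sub>g by (intro order_trans[OF S.H_shift_le] mult_right_mono mult_left_mono) auto
    have "norm (SG (\<sigma> k) y - S.smoothed_grad 0 y) \<le> (\<integral>z. L\<^sub>g * \<sigma> 0 * norm z \<partial>(std_gaussian :: 'a measure))"
      unfolding SG_def using shift
      by (intro S.smoothed_grad_close integrable_mult_right integrable_std_gaussian_norm) simp
    moreover have "S.smoothed_grad 0 y = grad (g (\<sigma> k)) y"
      using N.prob_space by (simp add: S.smoothed_grad_def)
    ultimately have close: "norm (SG (\<sigma> k) y - grad (g (\<sigma> k)) y) \<le> L\<^sub>g * \<sigma> 0 * \<psi>\<^sub>1"
      by (simp add: \<psi>\<^sub>1_def)
    have "norm (\<sigma> k *\<^sub>R z) \<le> \<sigma> 0 * norm z" using \<sigma>k by (simp add: mult_right_mono)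
    moreover have "grad (g (\<sigma> k)) (y + \<sigma> k *\<^sub>R z) - \<sigma> k *\<^sub>R z - SG (\<sigma> k) y
        = (grad (g (\<sigma> k)) (y + \<sigma> k *\<^sub>R z) - grad (g (\<sigma> k)) y) - \<sigma> k *\<^sub>R z - (SG (\<sigma> k) y - grad (g (\<sigma> k)) y)"
      by simp
    ultimately have "norm (grad (g (\<sigma> k)) (y + \<sigma> k *\<^sub>R z) - \<sigma> k *\<^sub>R z - SG (\<sigma> k) y)
        \<le> L\<^sub>g * \<sigma> 0 * norm z + \<sigma> 0 * norm z + L\<^sub>g * \<sigma> 0 * \<psi>\<^sub>1"
      using shift[of z] close by (smt (verit) norm_triangle_ineq4)
    then have "lam * norm (grad (g (\<sigma> k)) (y + \<sigma> k *\<^sub>R z) - \<sigma> k *\<^sub>R z - SG (\<sigma> k) y)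
        \<le> lam * (L\<^sub>g * \<sigma> 0 * norm z + \<sigma> 0 * norm z + L\<^sub>g * \<sigma> 0 * \<psi>\<^sub>1)"
      using lam_pos by (intro mult_left_mono) auto
    then show ?thesis using lam_pos by (simp add: \<nu>_def \<psi>_def distrib_left ac_simps)
  qed
  have \<nu>_integral: "(\<integral>z. \<nu> k y z \<partial>std_gaussian) = 0" for k y
  proof -
    interpret S: smooth_function "g (\<sigma> k)" "grad (g (\<sigma> k))" L\<^sub>g by (rule smooth[OF \<sigma>_I])
    have "(\<integral>z. grad (g (\<sigma> k)) (y + \<sigma> k *\<^sub>R z) - \<sigma> k *\<^sub>R z - SG (\<sigma> k) y \<partial>std_gaussian)
        = SG (\<sigma> k) y - \<sigma> k *\<^sub>R (\<integral>z. z \<partial>std_gaussian) - SG (\<sigma> k) y"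
      using S.integrable_grad_gaussian[of y "\<sigma> k"] N.prob_space
      by (simp add: SG_def S.smoothed_grad_def integrable_std_gaussian_id)
    then show ?thesis unfolding \<nu>_def by (simp add: integral_std_gaussian_id)
  qed
  have Z_Suc_distr: "distr M borel (Z (Suc k)) = std_gaussian" for k
    by (rule Z_distr) simp
  note noise = \<nu>_M \<psi>_M \<nu>_bound \<nu>_integral \<psi>_sq Z_Suc_distr x_adapted

  \<comment> \<open>Instance of the stochastic descent\<close>
  define \<delta> where "\<delta> = 1 - L * \<gamma>bar / 2"
  interpret sgd: stochastic_gradient_descent M "history M Z" n x F "\<lambda>k. OG (\<sigma> k)" \<gamma> a L \<kappa> v \<delta> x\<^sub>0
  proof unfold_locales
    show "(\<integral>w. U w \<bullet> n k w \<partial>M) = 0"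
      if "U \<in> borel_measurable (history M Z k)" "integrable M (\<lambda>w. norm (U w))" for k U
      unfolding n_def using noise_centred[OF noise that] .
    fix k and U :: "'w \<Rightarrow> real"
    assume U: "U \<in> borel_measurable (history M Z k)" "integrable M (\<lambda>w. (U w)\<^sup>2)"
    show "integrable M (\<lambda>w. (U w)\<^sup>2 * (norm (n k w))\<^sup>2)"
      unfolding n_def using noise_variance(1)[OF noise U] .
    show "(\<integral>w. (U w)\<^sup>2 * (norm (n k w))\<^sup>2 \<partial>M) \<le> v * (\<integral>w. (U w)\<^sup>2 \<partial>M)"
      unfolding n_def v_def using noise_variance(2)[OF noise U] .
  next
    show "L * \<gamma> k / 2 \<le> 1 - \<delta>" for k
      using mult_left_mono[OF \<gamma>_bounds(2) L] by (simp add: \<delta>_def)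
    show "\<delta> > 0" using \<gamma>bar by (simp add: \<delta>_def L_def)
  qed (rule space_history sets_history_Suc sets_history_le x_adapted x_init step F_GDERIV
      OG_lipschitz[OF \<sigma>_I] F_coercive \<kappa> F_drift a_nonneg a_summable \<gamma>_bounds(1)
      \<gamma>_square_summable | assumption)+

  \<comment> \<open>Passage to the limiting objective\<close>
  have \<gamma>_0: "\<gamma> \<longlonglongrightarrow> 0"
  proof -
    have "(\<lambda>k. sqrt ((\<gamma> k)\<^sup>2)) \<longlonglongrightarrow> sqrt 0"
      by (intro tendsto_real_sqrt summable_LIMSEQ_zero \<gamma>_square_summable)
    then show ?thesis using \<gamma>_bounds(1) by (simp add: less_imp_le)
  qed
  have OG_converge: "(\<lambda>k. norm (OG (\<sigma> k) (y k) - OG \<epsilon> (y k))) \<longlonglongrightarrow> 0" if y: "bounded (range y)" for y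
  proof (rule tendstoI)
    fix e :: real assume e: "e > 0"
    obtain R where R: "\<And>k. norm (y k) \<le> R" using y by (auto simp: bounded_iff)
    \<comment> \<open>The comparison distance is fixed first, with \<open>L * t < e\<close>; for
      this \<open>t\<close> the remaining term of \<open>grad_diff_le\<close> vanishes as
      \<open>k\<close> grows.\<close>
    define t where "t = (e / 2) / (L + 1)"
    have t: "t > 0" using e L by (simp add: t_def)
    have "L + 1 \<noteq> 0" using L by linarith
    from iffD1[OF nonzero_eq_divide_eq[OF this] t_def] have Lt: "L * t < e"
      using t e by (simp add: algebra_simps)
    \<comment> \<open>Bounds the gap of the objectives on the ball of radius \<open>R + t\<close>,
      which contains all comparison points.\<close>
    define D where "D k = lam * K * \<bar>\<sigma> k - \<epsilon>\<bar> * (1 + (R + t)\<^sup>2)" for k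
    have bound: "norm (OG (\<sigma> k) (y k) - OG \<epsilon> (y k)) \<le> L * t + 2 * D k / t" for k
    proof (rule grad_diff_le[OF obj_GDERIV[OF \<sigma>_I] OG_lipschitz[OF \<sigma>_I] obj_GDERIV[OF \<epsilon>_I] OG_lipschitz[OF \<epsilon>_I] t])
      fix p assume "norm (p - y k) \<le> t"
      then have "norm p \<le> R + t" using R[of k] norm_triangle_ineq2[of p "y k"] by linarith
      then have "(norm p)\<^sup>2 \<le> (R + t)\<^sup>2" by (intro power_mono) auto
      then have "lam * K * \<bar>\<sigma> k - \<epsilon>\<bar> * (1 + (norm p)\<^sup>2) \<le> D k"
        unfolding D_def using lam_pos K by (intro mult_left_mono) auto
      then show "\<bar>objective f lam g (\<sigma> k) p - objective f lam g \<epsilon> p\<bar> \<le> D k"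
        using obj_scale[OF \<epsilon>_I \<sigma>_I[of k], of p] by linarith
    qed
    have "(\<lambda>k. L * t + 2 * D k / t) \<longlonglongrightarrow> L * t + 2 * (lam * K * \<bar>\<epsilon> - \<epsilon>\<bar> * (1 + (R + t)\<^sup>2)) / t"
      unfolding D_def using t by (intro tendsto_intros \<sigma>_lim) auto
    then have "\<forall>\<^sub>F k in sequentially. L * t + 2 * D k / t < e"
      by (rule order_tendstoD) (use Lt in simp)
    then show "\<forall>\<^sub>F k in sequentially. dist (norm (OG (\<sigma> k) (y k) - OG \<epsilon> (y k))) 0 < e"
      by eventually_elim (use bound in \<open>auto intro: le_less_trans\<close>)
  qed

  \<comment> \<open>Almost sure convergence\<close>
  have "AE w in M.
      (\<lambda>k. norm (OG \<epsilon> (x k w))) \<longlonglongrightarrow> 0 \<and> (\<lambda>k. norm (x (Suc k) w - x k w)) \<longlonglongrightarrow> 0 \<and>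
      (\<forall>r l. strict_mono r \<longrightarrow> (\<lambda>n. x (r n) w) \<longlonglongrightarrow> l \<longrightarrow> l \<in> {y. OG \<epsilon> y = 0}) \<and>
      {y. OG \<epsilon> y = 0} \<noteq> {} \<and> (\<lambda>k. infdist (x k w) {y. OG \<epsilon> y = 0}) \<longlonglongrightarrow> 0"
    using sgd.bounded_AE sgd.gradient_sum_AE sgd.weighted_noise_AE AE_space
  proof eventually_elim
    case (elim w)
    define r where "r k = norm (OG (\<sigma> k) (x k w) - OG \<epsilon> (x k w))" for k
    have r: "r \<longlonglongrightarrow> 0" unfolding r_def using OG_converge[OF elim(1)] .
    \<comment> \<open>The gradients belong to different objectives, so both are compared with the
      one at \<open>\<epsilon>\<close>, at the cost of \<open>r i + r j\<close>.\<close>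
    have lip: "norm (OG (\<sigma> i) (x i w) - OG (\<sigma> j) (x j w)) \<le> L * norm (x i w - x j w) + r i + r j" for i j
    proof -
      have "norm (OG \<epsilon> (x i w) - OG \<epsilon> (x j w)) \<le> L * norm (x i w - x j w)"
        using lipschitz_on_normD[OF OG_lipschitz[OF \<epsilon>_I]] by simp
      moreover have "OG (\<sigma> i) (x i w) - OG (\<sigma> j) (x j w) = (OG \<epsilon> (x i w) - OG \<epsilon> (x j w))
          + (OG (\<sigma> i) (x i w) - OG \<epsilon> (x i w)) - (OG (\<sigma> j) (x j w) - OG \<epsilon> (x j w))"
        by simp
      ultimately show ?thesis
        unfolding r_def by (smt (verit) norm_triangle_ineq norm_triangle_ineq4)
    qed
    note conv = sgd_deterministic_convergence[where x = "\<lambda>k. x k w" and u = "\<lambda>k. OG (\<sigma> k) (x k w)",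
        OF step[OF elim(4)] \<gamma>_bounds(1) \<gamma>_diverges \<gamma>_0 elim(2,3) lip L r]
    have "(\<lambda>k. OG (\<sigma> k) (x k w) - (OG (\<sigma> k) (x k w) - OG \<epsilon> (x k w))) \<longlonglongrightarrow> 0 - 0"
      using r unfolding r_def by (intro tendsto_diff conv(1)) (rule tendsto_norm_zero_cancel)
    then have lim: "(\<lambda>k. OG \<epsilon> (x k w)) \<longlonglongrightarrow> 0" by simp
    note limits = bounded_vanishing_limit_points[OF elim(1)
        lipschitz_on_continuous_on[OF OG_lipschitz[OF \<epsilon>_I]] lim]
    show ?case
      using conv(2) limits tendsto_norm_zero[OF lim] by blast
  qed
  moreover have "crit (objective f lam g \<epsilon>) = {y. OG \<epsilon> y = 0}"
    by (simp add: crit_def grad_obj[OF \<epsilon>_I])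
  moreover have "integrable M (\<lambda>w. (norm (OG (\<sigma> k) (x k w)))\<^sup>2)" for k
    by (rule sgd.G_x_sq_integrable)

  \<comment> \<open>Rate in expectation\<close>
  moreover have "(\<lambda>K. MIN k\<in>{..K}. \<integral>w. (norm (OG (\<sigma> k) (x k w)))\<^sup>2 \<partial>M) \<in> O(\<lambda>K. inverse (\<Sum>j\<le>K. \<gamma> j))"
  proof (rule bigoI[OF always_eventually], rule allI)
    fix J
    define E where "E k = (\<integral>w. (norm (OG (\<sigma> k) (x k w)))\<^sup>2 \<partial>M)" for k
    define A where "A = (MIN k\<in>{..J}. E k)"
    have "A \<in> E ` {..J}" unfolding A_def by (rule Min_in) auto
    then have A: "A \<ge> 0" by (auto simp: E_def)
    have S: "(\<Sum>j\<le>J. \<gamma> j) > 0" using \<gamma>_bounds(1) by (intro sum_pos) auto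
    \<comment> \<open>A minimum is at most the \<open>\<gamma>\<close>-weighted average, whose
      numerator is bounded independently of \<open>J\<close>.\<close>
    have "A * (\<Sum>j\<le>J. \<gamma> j) = (\<Sum>j\<le>J. \<gamma> j * A)" by (simp add: sum_distrib_left mult.commute)
    also have "\<dots> \<le> (\<Sum>j\<le>J. \<gamma> j * E j)"
      unfolding A_def using \<gamma>_bounds(1) by (intro sum_mono mult_left_mono Min_le) (auto simp: less_imp_le)
    also have "\<dots> \<le> exp (suminf a) * sgd.B / \<delta>"
      using sgd.expected_gradient_sum[of "Suc J"] unfolding lessThan_Suc_atMost E_def .
    finally have "A \<le> exp (suminf a) * sgd.B / \<delta> * inverse (\<Sum>j\<le>J. \<gamma> j)"
      by (simp only: divide_inverse[symmetric] pos_le_divide_eq[OF S])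
    then show "norm (MIN k\<in>{..J}. \<integral>w. (norm (OG (\<sigma> k) (x k w)))\<^sup>2 \<partial>M)
        \<le> exp (suminf a) * sgd.B / \<delta> * norm (inverse (\<Sum>j\<le>J. \<gamma> j))"
      using A S unfolding A_def E_def by simp
  qed
  ultimately show ?thesis
    by (simp add: grad_obj[OF \<sigma>_I] grad_obj[OF \<epsilon>_I])
qed

end
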